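(* Let $(N,\underline X)\in\aleph^{FGM*}$ with $E[N^k]<\infty$ and $E[X^k]<\infty$ for $k=1,2$. Write $R_n=\frac{\gamma_{N_{[2]}}(n)-\gamma_{N_{[1]}}(n)}{\gamma_N(n)}$ for $n\in A_N$ and $D=\mu_{X_{[2]}}-\mu_{X_{[1]}}$. Then $\mathrm{Var}(S)=E[N\,\mathrm{Var}(X_1\mid N)]+E[N(N-1)\mathrm{Cov}(X_1,X_2\mid N)]+\mathrm{Var}(N\,E[X_1\mid N])$ (with the middle term equal to $0$ if $\sup A_N\le1$), where $$E[N\mathrm{Var}(X_1\mid N)]=E[N]\mathrm{Var}(X)+\frac{\theta_{01}}{4}(\mu_{N_{[2]}}-\mu_{N_{[1]}})\big(\mathrm{Var}(X_{[2]})-\mathrm{Var}(X_{[1]})\big)-\frac{\theta_{01}^2}{16}D^2\sum_{n\ge1}\gamma_N(n)\,n\,R_n^2,$$ $$E[N(N-1)\mathrm{Cov}(X_1,X_2\mid N)]=\frac{\theta_{12}}{4}(\mu_N^{(2)}-\mu_N)D^2-\frac{\theta_{012}}{8}\big(\mu^{(2)}_{N_{[2]}}-\mu_{N_{[2]}}-\mu^{(2)}_{N_{[1]}}+\mu_{N_{[1]}}\big)D^2-\frac{\theta_{01}^2}{16}D^2\sum_{n\ge1}\gamma_N(n)n^2R_n^2+\frac{\theta_{01}^2}{16}D^2\sum_{n\ge1}\gamma_N(n)\,n\,R_n^2,$$ $$\mathrm{Var}(NE[X_1\mid N])=\mathrm{Var}(N)E[X]^2+\frac{\theta_{01}}{4}\big(\mathrm{Var}(N_{[2]})-\mathrm{Var}(N_{[1]})\big)(\mu_{X_{[2]}}^2-\mu_{X_{[1]}}^2)+\frac{\theta_{01}}{8}(\mu_{N_{[2]}}^2-\mu_{N_{[1]}}^2)(\mu_{X_{[2]}}^2-\mu_{X_{[1]}}^2)+\frac{\theta_{01}^2}{16}D^2\sum_{n\ge1}\gamma_N(n)n^2R_n^2-\frac{\theta_{01}^2}{16}(\mu_{N_{[2]}}-\mu_{N_{[1]}})^2D^2.$$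 Consequently $\mathrm{Var}(S)=E[N]\mathrm{Var}(X)+\mathrm{Var}(N)E[X]^2+C^{Var}_{Dep}(S)$ with $$C^{Var}_{Dep}(S)=\frac{\theta_{01}}{4}\Big[(\mu_{N_{[2]}}-\mu_{N_{[1]}})\big(\mathrm{Var}(X_{[2]})-\mathrm{Var}(X_{[1]})\big)+\big(\mathrm{Var}(N_{[2]})-\mathrm{Var}(N_{[1]})\big)(\mu_{X_{[2]}}^2-\mu_{X_{[1]}}^2)+\tfrac12(\mu_{N_{[2]}}^2-\mu_{N_{[1]}}^2)(\mu_{X_{[2]}}^2-\mu_{X_{[1]}}^2)\Big]$$ $$\quad-\frac{\theta_{01}^2}{16}(\mu_{N_{[2]}}-\mu_{N_{[1]}})^2D^2+\frac{\theta_{12}}{4}(\mu_N^{(2)}-\mu_N)D^2-\frac{\theta_{012}}{8}\Big[(\mu^{(2)}_{N_{[2]}}-\mu_{N_{[2]}})-(\mu^{(2)}_{N_{[1]}}-\mu_{N_{[1]}})\Big]D^2.$$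
   Context: Collective risk model (CRM): $N$ is a random variable with values in $\mathbb{N}_0$, cdf $F_N$, pmf $\gamma_N(n)=\Pr(N=n)$ and support $A_N=\{n:\gamma_N(n)>0\}$; $\underline X=\{X_j\}_{j\ge1}$ is a sequence of identically distributed strictly positive random variables with common cdf $F_X$ (generic copy $X$). The aggregate claim amount is $S=\sum_{j=1}^\infty X_j\mathbb{1}_{\{N\ge j\}}$. A $d$-variate FGM copula with parameters $\theta_{j_1\dots j_k}$ is $C(u_1,\dots,u_d)=\prod_{m=1}^d u_m\big(1+\sum_{k=2}^d\sum_{j_1<\dots<j_k}\theta_{j_1\dots j_k}\bar u_{j_1}\cdots\bar u_{j_k}\big)$, $\bar u=1-u$, with parameters such that $1+\sum_{k}\sum_{j_1<\dots<j_k}\theta_{j_1\dots j_k}\varepsilon_{j_1}\cdots\varepsilon_{j_k}\ge0$ for all $\varepsilon\in\{-1,1\}^d$. A CRM belongs to $\aleph^{FGM}$ if for every $k\in\mathbb{N}_1$, $k\le\sup A_N$, $F_{N,X_1,\dots,X_k}(n,x_1,\dots,x_k)=C_k(F_N(n),F_X(x_1),\dots,F_X(x_k))$ for a $(k+1)$-variate FGM copula $C_k$ with coordinates indexed $0,\dots,k$ (index $0$ for $N$). It belongs to $\aleph^{FGM*}$ if in addition $(N,X_1,\dots,X_k)\overset d=(N,X_{\pi(1)},\dots,X_{\pi(k)})$ for all such $k$ and all permutations $\pi$; then $\theta_{0j}=\theta_{01}$, $\theta_{ij}=\theta_{12}$, $\theta_{0ij}=\theta_{012}$ for all $1\le i<j$.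 For a random variable $Y$, $Y_{[1]}$, $Y_{[2]}$ denote the minimum and maximum of two iid copies of $Y$; $\mu_{Y_{[j]}}=E[Y_{[j]}]$, $\mu^{(2)}_{Y_{[j]}}=E[Y_{[j]}^2]$, and $\mu_{Y_{[j]}}^2$ means $(\mu_{Y_{[j]}})^2$; $\mu_N=E[N]$, $\mu_N^{(2)}=E[N^2]$; $\gamma_{N_{[j]}}(n)=\Pr(N_{[j]}=n)$. *)

theory Defs
  imports "HOL-Probability.Probability"
begin

definition fgm_copula :: "nat set \<Rightarrow> (nat set \<Rightarrow> real) \<Rightarrow> (nat \<Rightarrow> real) \<Rightarrow> real" where
  "fgm_copula I \<theta> u =
     (\<Prod>m\<in>I. u m) *
     (1 + (\<Sum>S\<in>{S. S \<subseteq> I \<and> 2 \<le> card S}. \<theta> S * (\<Prod>j\<in>S. 1 - u j)))"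

text \<open>Admissibility of the FGM parameters (the copula is then a genuine copula).\<close>
definition fgm_admissible :: "nat set \<Rightarrow> (nat set \<Rightarrow> real) \<Rightarrow> bool" where
  "fgm_admissible I \<theta> \<longleftrightarrow>
     (\<forall>\<epsilon>. (\<forall>j\<in>I. \<epsilon> j = 1 \<or> \<epsilon> j = -1) \<longrightarrow>
        0 \<le> 1 + (\<Sum>S\<in>{S. S \<subseteq> I \<and> 2 \<le> card S}. \<theta> S * (\<Prod>j\<in>S. (\<epsilon> j :: real))))"

definition gammaN :: "'a measure \<Rightarrow> ('a \<Rightarrow> nat) \<Rightarrow> nat \<Rightarrow> real" where
  "gammaN M N n = measure M {\<omega> \<in> space M. N \<omega> = n}"

text \<open>k is an admissible index: 1 <= k <= sup A_N, A_N = support of N.\<close>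
definition crm_index :: "'a measure \<Rightarrow> ('a \<Rightarrow> nat) \<Rightarrow> nat \<Rightarrow> bool" where
  "crm_index M N k \<longleftrightarrow> 1 \<le> k \<and> (\<exists>n. gammaN M N n > 0 \<and> k \<le> n)"

text \<open>Basic CRM assumptions: N counting r.v., X_1, X_2, ... (index 0 unused)
  identically distributed, strictly positive random variables.\<close>
definition CRM :: "'a measure \<Rightarrow> ('a \<Rightarrow> nat) \<Rightarrow> (nat \<Rightarrow> 'a \<Rightarrow> real) \<Rightarrow> bool" where
  "CRM M N X \<longleftrightarrow> prob_space M \<and>
     N \<in> measurable M (count_space UNIV) \<and>
     (\<forall>j\<ge>1. X j \<in> borel_measurable M) \<and>
     (\<forall>j\<ge>1. distr M borel (X j) = distr M borel (X 1)) \<and>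
     (\<forall>j\<ge>1. AE \<omega> in M. X j \<omega> > 0)"

definition aggS :: "('a \<Rightarrow> nat) \<Rightarrow> (nat \<Rightarrow> 'a \<Rightarrow> real) \<Rightarrow> 'a \<Rightarrow> real" where
  "aggS N X \<omega> = (\<Sum>j\<in>{1..N \<omega>}. X j \<omega>)"

text \<open>The class aleph^FGM, with copula parameters theta k for the (k+1)-variate copula
  C_k, coordinates 0..k (0 for N).\<close>
definition in_FGM :: "'a measure \<Rightarrow> ('a \<Rightarrow> nat) \<Rightarrow> (nat \<Rightarrow> 'a \<Rightarrow> real) \<Rightarrow> (nat \<Rightarrow> nat set \<Rightarrow> real) \<Rightarrow> bool" where
  "in_FGM M N X \<theta> \<longleftrightarrow>
     (\<forall>k. crm_index M N k \<longrightarrow>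
        fgm_admissible {0..k} (\<theta> k) \<and>
        (\<forall>(t::real) (x::nat \<Rightarrow> real).
           measure M {\<omega> \<in> space M. real (N \<omega>) \<le> t \<and> (\<forall>j\<in>{1..k}. X j \<omega> \<le> x j)} =
           fgm_copula {0..k} (\<theta> k)
             (\<lambda>i. if i = 0 then measure M {\<omega> \<in> space M. real (N \<omega>) \<le> t}
                  else measure M {\<omega> \<in> space M. X 1 \<omega> \<le> x i})))"

definition crm_vec :: "('a \<Rightarrow> nat) \<Rightarrow> (nat \<Rightarrow> 'a \<Rightarrow> real) \<Rightarrow> nat \<Rightarrow> (nat \<Rightarrow> nat) \<Rightarrow> 'a \<Rightarrow> nat \<Rightarrow> real" where
  "crm_vec N X k g \<omega> = (\<lambda>i\<in>{0..k}. if i = 0 then real (N \<omega>) else X (g i) \<omega>)"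

definition in_FGM_star :: "'a measure \<Rightarrow> ('a \<Rightarrow> nat) \<Rightarrow> (nat \<Rightarrow> 'a \<Rightarrow> real) \<Rightarrow> (nat \<Rightarrow> nat set \<Rightarrow> real) \<Rightarrow> bool" where
  "in_FGM_star M N X \<theta> \<longleftrightarrow> in_FGM M N X \<theta> \<and>
     (\<forall>k \<pi>. crm_index M N k \<longrightarrow> bij_betw \<pi> {1..k} {1..k} \<longrightarrow>
        distr M (PiM {0..k} (\<lambda>_. borel)) (crm_vec N X k id) =
        distr M (PiM {0..k} (\<lambda>_. borel)) (crm_vec N X k \<pi>))"

definition law_min2 :: "real measure \<Rightarrow> real measure" where
  "law_min2 D = distr (D \<Otimes>\<^sub>M D) borel (\<lambda>(a, b). min a b)"

definition law_max2 :: "real measure \<Rightarrow> real measure" where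
  "law_max2 D = distr (D \<Otimes>\<^sub>M D) borel (\<lambda>(a, b). max a b)"

definition mom1 :: "real measure \<Rightarrow> real" where
  "mom1 D = (\<integral>x. x \<partial>D)"

definition mom2 :: "real measure \<Rightarrow> real" where
  "mom2 D = (\<integral>x. x ^ 2 \<partial>D)"

definition var :: "real measure \<Rightarrow> real" where
  "var D = mom2 D - (mom1 D) ^ 2"

definition cexp :: "'a measure \<Rightarrow> ('a \<Rightarrow> nat) \<Rightarrow> ('a \<Rightarrow> real) \<Rightarrow> nat \<Rightarrow> real" where
  "cexp M N f n =
     (\<integral>\<omega>. indicator {\<omega> \<in> space M. N \<omega> = n} \<omega> * f \<omega> \<partial>M) / gammaN M N n"

definition cvar :: "'a measure \<Rightarrow> ('a \<Rightarrow> nat) \<Rightarrow> ('a \<Rightarrow> real) \<Rightarrow> nat \<Rightarrow> real" where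
  "cvar M N f n = cexp M N (\<lambda>\<omega>. (f \<omega>) ^ 2) n - (cexp M N f n) ^ 2"

definition ccov :: "'a measure \<Rightarrow> ('a \<Rightarrow> nat) \<Rightarrow> ('a \<Rightarrow> real) \<Rightarrow> ('a \<Rightarrow> real) \<Rightarrow> nat \<Rightarrow> real" where
  "ccov M N f g n = cexp M N (\<lambda>\<omega>. f \<omega> * g \<omega>) n - cexp M N f n * cexp M N g n"


definition lawN :: "'a measure \<Rightarrow> ('a \<Rightarrow> nat) \<Rightarrow> real measure" where
  "lawN M N = distr M borel (\<lambda>\<omega>. real (N \<omega>))"

definition lawX :: "'a measure \<Rightarrow> (nat \<Rightarrow> 'a \<Rightarrow> real) \<Rightarrow> real measure" where
  "lawX M X = distr M borel (X 1)"

definition gammaN1 :: "'a measure \<Rightarrow> ('a \<Rightarrow> nat) \<Rightarrow> nat \<Rightarrow> real" where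
  "gammaN1 M N n = measure (law_min2 (lawN M N)) {real n}"

definition gammaN2 :: "'a measure \<Rightarrow> ('a \<Rightarrow> nat) \<Rightarrow> nat \<Rightarrow> real" where
  "gammaN2 M N n = measure (law_max2 (lawN M N)) {real n}"

definition Rratio :: "'a measure \<Rightarrow> ('a \<Rightarrow> nat) \<Rightarrow> nat \<Rightarrow> real" where
  "Rratio M N n = (gammaN2 M N n - gammaN1 M N n) / gammaN M N n"

definition Ddiff :: "'a measure \<Rightarrow> (nat \<Rightarrow> 'a \<Rightarrow> real) \<Rightarrow> real" where
  "Ddiff M X = mom1 (law_max2 (lawX M X)) - mom1 (law_min2 (lawX M X))"

end

theory Submission
  imports Defs
begin

text \<open>
  With F the cdf of Y, the minimum and maximum of two independent copies have survival functions
  \<open>(1 - F)\<^sup>2\<close> and \<open>1 - F\<^sup>2\<close>, so on the half line \<open>F (1 - F)\<close> integrates to half of the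
  difference of their means. Differencing the FGM copula in its N-coordinate gives the survival
  function of X, or of a pair of claims, on the event N = n as a polynomial in \<open>1 - F\<close> and
  \<open>F (1 - F)\<close>; integrating it (layer cake) yields the conditional moments, which are affine in
  \<open>R\<^sub>n\<close>. Since \<open>R\<^sub>n = 2 (P(N \<le> n) + P(N < n) - 1)\<close> is bounded by 2, all expectations reduce to
  those of \<open>N\<^sup>p R\<^sub>N\<^sup>q\<close>, and \<open>Var(S)\<close> follows by conditioning on N and exchangeability of the claims.
\<close>

section \<open>Layer-cake representation of expectations\<close>

text \<open>The law of a claim is arbitrary on the half line, so there is no density to integrate;
  only joint cdfs are given, and everything is read off from them on the events N = n. The
  layer-cake formula carries a weight for that reason: the indicator of the event is the weight, and
  for a product of two claims the formula is applied twice, one claim moving into the weight on the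
  second pass. The constants are products of halves. Each claim occurring in a copula term
  contributes \<open>F (1 - F)\<close>, which integrates to D/2 and enters survival functions with a
  minus sign; coordinate 0 contributes -(\<open>gammaN\<close> * R)/2. Hence the term with one claim
  and N gives +1/4, the term with two claims +1/4, and the term with two claims and N gives -1/8.
  The factors 1/16 are squares of theta01/4. The copulas constrain only n in the support with n at
  least 1 (at least 2 for pairs), so the identities in N hold almost surely and the factors n and
  n(n - 1) dispose of the remaining small values.\<close>

lemma (in sigma_finite_measure) nn_integral_layer_cake:
  fixes Z :: "'a \<Rightarrow> real"
  assumes [measurable]: "W \<in> borel_measurable M" "Z \<in> borel_measurable M"
  shows "(\<integral>\<^sup>+\<omega>. W \<omega> * ennreal (Z \<omega>) \<partial>M)
    = (\<integral>\<^sup>+s. indicator {0..} s * (\<integral>\<^sup>+\<omega>. W \<omega> * indicator {s<..} (Z \<omega>) \<partial>M) \<partial>lborel)"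
proof -
  interpret P: pair_sigma_finite M lborel ..
  \<comment> \<open>The right side is the length of \<open>{0..<z}\<close>; for negative
    \<open>z\<close> that interval is empty and \<open>ennreal\<close> truncates to 0, so both sides
    agree.\<close>
  have e: "ennreal z = (\<integral>\<^sup>+s. indicator {0..} s * indicator {s<..} z \<partial>lborel)" for z :: real
  proof -
    have "(\<integral>\<^sup>+s. indicator {0..} s * indicator {s<..} z \<partial>lborel)
      = (\<integral>\<^sup>+s. indicator {0..<z} s \<partial>lborel)"
      by (intro nn_integral_cong) (auto split: split_indicator)
    then show ?thesis
      by (cases "0 \<le> z") (auto simp: ennreal_neg)
  qed
  have "(\<integral>\<^sup>+\<omega>. W \<omega> * ennreal (Z \<omega>) \<partial>M)
    = (\<integral>\<^sup>+\<omega>. (\<integral>\<^sup>+s. W \<omega> * (indicator {0..} s * indicator {..<Z \<omega>} s) \<partial>lborel) \<partial>M)"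
    by (subst e) (simp add: nn_integral_cmult indicator_def)
  also have "\<dots> = (\<integral>\<^sup>+s. (\<integral>\<^sup>+\<omega>. W \<omega> * (indicator {0..} s * indicator {..<Z \<omega>} s) \<partial>M) \<partial>lborel)"
    by (rule P.Fubini'[symmetric]) (simp add: indicator_def)
  also have "\<dots> = (\<integral>\<^sup>+s. indicator {0..} s * (\<integral>\<^sup>+\<omega>. W \<omega> * indicator {s<..} (Z \<omega>) \<partial>M) \<partial>lborel)"
    by (intro nn_integral_cong, subst nn_integral_cmult[symmetric])
       (auto intro!: nn_integral_cong split: split_indicator)
  finally show ?thesis .
qed

text \<open>Stated with \<open>has_bochner_integral\<close> so that a value can be identified by
  uniqueness: the survival function is rewritten as a combination of functions with known integrals.
  The weights used later are 1, the indicator of an event, that indicator times a threshold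
  indicator of another variable, and that indicator times a nonnegative variable.\<close>

lemma (in sigma_finite_measure) has_bochner_integral_layer_cake:
  fixes W Z :: "'a \<Rightarrow> real"
  assumes W: "integrable M W" "AE \<omega> in M. 0 \<le> W \<omega>"
    and Z [measurable]: "Z \<in> borel_measurable M" and "AE \<omega> in M. 0 \<le> Z \<omega>"
    and WZ: "integrable M (\<lambda>\<omega>. W \<omega> * Z \<omega>)"
  shows "has_bochner_integral lborel
    (\<lambda>s. indicator {0..} s * (\<integral>\<omega>. W \<omega> * indicator {s<..} (Z \<omega>) \<partial>M)) (\<integral>\<omega>. W \<omega> * Z \<omega> \<partial>M)"
proof -
  have [measurable]: "W \<in> borel_measurable M" using W by auto
  have pos: "AE \<omega> in M. 0 \<le> W \<omega> * Z \<omega>" using assms(2,4) by eventually_elim simp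
  have int: "integrable M (\<lambda>\<omega>. W \<omega> * indicator {s<..} (Z \<omega>))" for s
    by (rule Bochner_Integration.integrable_bound[OF W(1)]) (auto split: split_indicator)
  have ge: "AE \<omega> in M. 0 \<le> W \<omega> * indicator {s<..} (Z \<omega>)" for s
    using assms(2) by eventually_elim (auto split: split_indicator)
  have "(\<integral>\<^sup>+s. ennreal (indicator {0..} s * (\<integral>\<omega>. W \<omega> * indicator {s<..} (Z \<omega>) \<partial>M)) \<partial>lborel)
    = (\<integral>\<^sup>+s. indicator {0..} s * (\<integral>\<^sup>+\<omega>. ennreal (W \<omega>) * indicator {s<..} (Z \<omega>) \<partial>M) \<partial>lborel)"
  proof (intro nn_integral_cong)
    fix s :: real
    have "ennreal (\<integral>\<omega>. W \<omega> * indicator {s<..} (Z \<omega>) \<partial>M)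
      = (\<integral>\<^sup>+\<omega>. ennreal (W \<omega> * indicator {s<..} (Z \<omega>)) \<partial>M)"
      by (rule nn_integral_eq_integral[OF int ge, symmetric])
    also have "\<dots> = (\<integral>\<^sup>+\<omega>. ennreal (W \<omega>) * indicator {s<..} (Z \<omega>) \<partial>M)"
      by (intro nn_integral_cong) (auto split: split_indicator)
    finally show "ennreal (indicator {0..} s * (\<integral>\<omega>. W \<omega> * indicator {s<..} (Z \<omega>) \<partial>M))
      = indicator {0..} s * (\<integral>\<^sup>+\<omega>. ennreal (W \<omega>) * indicator {s<..} (Z \<omega>) \<partial>M)"
      by (auto split: split_indicator)
  qed
  also have "\<dots> = (\<integral>\<^sup>+\<omega>. ennreal (W \<omega>) * ennreal (Z \<omega>) \<partial>M)"
    by (subst nn_integral_layer_cake) auto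
  also have "\<dots> = (\<integral>\<^sup>+\<omega>. ennreal (W \<omega> * Z \<omega>) \<partial>M)"
    by (rule nn_integral_cong_AE) (use assms(2,4) in eventually_elim, simp add: ennreal_mult)
  also have "\<dots> = ennreal (\<integral>\<omega>. W \<omega> * Z \<omega> \<partial>M)"
    by (rule nn_integral_eq_integral[OF WZ pos])
  finally show ?thesis
  proof (intro has_bochner_integral_nn_integral)
    \<comment> \<open>Measurability of a parameter integral follows from joint measurability of the
      integrand, visible once the indicator is read as the condition
      \<open>s < Z \<omega>\<close>.\<close>
    have "(\<lambda>s. \<integral>\<omega>. W \<omega> * indicator {..<Z \<omega>} s \<partial>M) \<in> borel_measurable lborel"
      unfolding indicator_def lessThan_iff by measurable
    also have "(\<lambda>s. \<integral>\<omega>. W \<omega> * indicator {..<Z \<omega>} s \<partial>M) = (\<lambda>s. \<integral>\<omega>. W \<omega> * indicator {s<..} (Z \<omega>) \<partial>M)"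
      by (simp add: indicator_def)
    finally show "(\<lambda>s. indicator {0..} s * (\<integral>\<omega>. W \<omega> * indicator {s<..} (Z \<omega>) \<partial>M))
      \<in> borel_measurable lborel" by simp
  qed (use pos ge in \<open>auto intro!: AE_I2 mult_nonneg_nonneg intro: integral_nonneg_AE\<close>)
qed

context prob_space
begin

section \<open>Expectations as sums over the values of N\<close>

text \<open>At each point exactly one summand is nonzero, so pointwise convergence is trivial;
  summability of the absolute integrals is what permits exchanging sum and integral, and it also
  yields integrability of \<open>Z\<close>.\<close>

lemma integrable_partition_nat:
  fixes N :: "'a \<Rightarrow> nat" and Z :: "'a \<Rightarrow> real"
  assumes [measurable]: "N \<in> measurable M (count_space UNIV)" "Z \<in> borel_measurable M"
    and int: "\<And>n. integrable M (\<lambda>\<omega>. indicator {\<omega>\<in>space M. N \<omega> = n} \<omega> * Z \<omega>)"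
    and sm: "summable (\<lambda>n. \<integral>\<omega>. indicator {\<omega>\<in>space M. N \<omega> = n} \<omega> * \<bar>Z \<omega>\<bar> \<partial>M)"
  shows "integrable M Z"
    and "(\<lambda>n. \<integral>\<omega>. indicator {\<omega>\<in>space M. N \<omega> = n} \<omega> * Z \<omega> \<partial>M) sums (\<integral>\<omega>. Z \<omega> \<partial>M)"
proof -
  let ?f = "\<lambda>n \<omega>. indicator {\<omega>\<in>space M. N \<omega> = n} \<omega> * Z \<omega>"
  have nz: "?f n \<omega> = (if n = N \<omega> then Z \<omega> else 0)" if "\<omega> \<in> space M" for n \<omega>
    using that by auto
  have s: "(\<lambda>n. ?f n \<omega>) sums Z \<omega>" if "\<omega> \<in> space M" for \<omega>
    unfolding nz[OF that] using sums_single[of "N \<omega>" "\<lambda>_. Z \<omega>"] by simp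
  have ae: "AE \<omega> in M. summable (\<lambda>n. norm (?f n \<omega>))"
  proof (rule AE_I2)
    fix \<omega> assume w: "\<omega> \<in> space M"
    show "summable (\<lambda>n. norm (?f n \<omega>))"
      unfolding nz[OF w] if_distrib[of norm] using sums_single[of "N \<omega>" "\<lambda>_. norm (Z \<omega>)"]
      by (auto simp: sums_iff cong: if_cong)
  qed
  have sm': "summable (\<lambda>n. \<integral>\<omega>. norm (?f n \<omega>) \<partial>M)"
    using sm by (simp add: abs_mult)
  have eq: "(\<Sum>n. ?f n \<omega>) = Z \<omega>" if "\<omega> \<in> space M" for \<omega>
    using s[OF that] by (simp add: sums_iff)
  show "integrable M Z"
    using integrable_suminf[OF int ae sm'] by (simp add: eq cong: Bochner_Integration.integrable_cong)
  show "(\<lambda>n. \<integral>\<omega>. ?f n \<omega> \<partial>M) sums (\<integral>\<omega>. Z \<omega> \<partial>M)"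
    using sums_integral[OF int ae sm'] by (simp add: eq cong: Bochner_Integration.integral_cong)
qed

lemma gammaN_nonneg: "0 \<le> gammaN M N n"
  by (simp add: gammaN_def)

lemma expectation_gammaN_sums:
  fixes N :: "'a \<Rightarrow> nat" and h :: "nat \<Rightarrow> real"
  assumes [measurable]: "N \<in> measurable M (count_space UNIV)"
    and int: "integrable M (\<lambda>\<omega>. h (N \<omega>))"
  shows "(\<lambda>n. gammaN M N n * h n) sums (\<integral>\<omega>. h (N \<omega>) \<partial>M)"
proof -
  have ind: "integrable M (indicat_real {\<omega>\<in>space M. N \<omega> = n})" for n
    by (auto intro!: integrable_real_indicator simp: emeasure_eq_measure)
  have i: "integrable M (\<lambda>\<omega>. indicator {\<omega>\<in>space M. N \<omega> = n} \<omega> * f (N \<omega>))"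
    "(\<integral>\<omega>. indicator {\<omega>\<in>space M. N \<omega> = n} \<omega> * f (N \<omega>) \<partial>M) = gammaN M N n * f n"
    for f :: "nat \<Rightarrow> real" and n
  proof -
    have e: "(\<lambda>\<omega>. indicator {\<omega>\<in>space M. N \<omega> = n} \<omega> * f (N \<omega>))
      = (\<lambda>\<omega>. indicator {\<omega>\<in>space M. N \<omega> = n} \<omega> * f n)"
      by (auto split: split_indicator)
    show "integrable M (\<lambda>\<omega>. indicator {\<omega>\<in>space M. N \<omega> = n} \<omega> * f (N \<omega>))"
      unfolding e by (intro integrable_mult_left ind)
    show "(\<integral>\<omega>. indicator {\<omega>\<in>space M. N \<omega> = n} \<omega> * f (N \<omega>) \<partial>M) = gammaN M N n * f n"
      unfolding e by (simp add: gammaN_def)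
  qed
  \<comment> \<open>Absolute convergence: each partial sum is the expectation of |h(N)| restricted
    to N < m.\<close>
  have bd: "(\<Sum>n<m. gammaN M N n * \<bar>h n\<bar>) \<le> (\<integral>\<omega>. \<bar>h (N \<omega>)\<bar> \<partial>M)" for m
  proof -
    have "(\<Sum>n<m. gammaN M N n * \<bar>h n\<bar>)
      = (\<integral>\<omega>. (\<Sum>n<m. indicator {\<omega>\<in>space M. N \<omega> = n} \<omega> * \<bar>h n\<bar>) \<partial>M)"
      by (subst Bochner_Integration.integral_sum) (auto simp: gammaN_def ind)
    also have "\<dots> \<le> (\<integral>\<omega>. \<bar>h (N \<omega>)\<bar> \<partial>M)"
    proof (rule integral_mono)
      fix \<omega> assume "\<omega> \<in> space M"
      then have "(\<Sum>n<m. indicator {\<omega>\<in>space M. N \<omega> = n} \<omega> * \<bar>h n\<bar>)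
        = (\<Sum>n<m. if n = N \<omega> then \<bar>h n\<bar> else 0)"
        by (intro sum.cong) auto
      also have "\<dots> \<le> \<bar>h (N \<omega>)\<bar>" by simp
      finally show "(\<Sum>n<m. indicator {\<omega>\<in>space M. N \<omega> = n} \<omega> * \<bar>h n\<bar>) \<le> \<bar>h (N \<omega>)\<bar>" .
    next
      show "integrable M (\<lambda>\<omega>. \<Sum>n<m. indicator {\<omega>\<in>space M. N \<omega> = n} \<omega> * \<bar>h n\<bar>)"
        by (intro Bochner_Integration.integrable_sum integrable_mult_left ind)
    qed (use int in simp)
    finally show ?thesis .
  qed
  have "summable (\<lambda>n. gammaN M N n * \<bar>h n\<bar>)"
    by (rule summableI_nonneg_bounded[OF _ bd]) (simp add: gammaN_nonneg)
  then have "summable (\<lambda>n. \<integral>\<omega>. indicator {\<omega>\<in>space M. N \<omega> = n} \<omega> * \<bar>h (N \<omega>)\<bar> \<partial>M)"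
    unfolding i(2)[of _ "\<lambda>n. \<bar>h n\<bar>"] .
  from integrable_partition_nat(2)[OF assms(1) borel_measurable_integrable[OF int] i(1) this]
  show ?thesis unfolding i(2) .
qed

text \<open>Total expectation, with \<open>h n\<close> in the role of the conditional mean.
  Integrability of \<open>Z\<close> is a conclusion, obtained from nonnegativity and integrability
  of \<open>h (N \<omega>)\<close>; this is how the aggregate claim and its square are shown
  integrable.\<close>

lemma tower_nat:
  fixes N :: "'a \<Rightarrow> nat" and Z :: "'a \<Rightarrow> real"
  assumes [measurable]: "N \<in> measurable M (count_space UNIV)" "Z \<in> borel_measurable M"
    and pos: "AE \<omega> in M. 0 \<le> Z \<omega>"
    and int: "\<And>n. integrable M (\<lambda>\<omega>. indicator {\<omega>\<in>space M. N \<omega> = n} \<omega> * Z \<omega>)"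
    and eq: "\<And>n. (\<integral>\<omega>. indicator {\<omega>\<in>space M. N \<omega> = n} \<omega> * Z \<omega> \<partial>M) = gammaN M N n * h n"
    and h: "integrable M (\<lambda>\<omega>. h (N \<omega>))"
  shows "integrable M Z" "(\<integral>\<omega>. Z \<omega> \<partial>M) = (\<integral>\<omega>. h (N \<omega>) \<partial>M)"
proof -
  have "(\<integral>\<omega>. indicator {\<omega>\<in>space M. N \<omega> = n} \<omega> * \<bar>Z \<omega>\<bar> \<partial>M) = gammaN M N n * h n" for n
    unfolding eq[symmetric] by (rule integral_cong_AE) (use pos in auto)
  then have sm: "summable (\<lambda>n. \<integral>\<omega>. indicator {\<omega>\<in>space M. N \<omega> = n} \<omega> * \<bar>Z \<omega>\<bar> \<partial>M)"
    using expectation_gammaN_sums[of N h] h by (simp add: sums_iff)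
  show "integrable M Z"
    by (rule integrable_partition_nat(1)[OF assms(1,2) int sm])
  show "(\<integral>\<omega>. Z \<omega> \<partial>M) = (\<integral>\<omega>. h (N \<omega>) \<partial>M)"
    using integrable_partition_nat(2)[OF assms(1,2) int sm] expectation_gammaN_sums[of N h] h
    by (simp add: eq sums_unique2)
qed

section \<open>Minimum and maximum of two independent copies\<close>

lemma measure_pair_square:
  assumes "Measurable.pred M P"
  shows "measure (M \<Otimes>\<^sub>M M) {p\<in>space (M \<Otimes>\<^sub>M M). P (fst p) \<and> P (snd p)} = prob {\<omega>\<in>space M. P \<omega>} ^ 2"
proof -
  have "{p\<in>space (M \<Otimes>\<^sub>M M). P (fst p) \<and> P (snd p)} = {\<omega>\<in>space M. P \<omega>} \<times> {\<omega>\<in>space M. P \<omega>}"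
    by (auto simp: space_pair_measure)
  then show ?thesis
    using assms by (simp add: measure_def emeasure_pair_measure_Times enn2real_mult power2_eq_square)
qed

lemma measure_pair_disj:
  assumes [measurable]: "Measurable.pred M P"
  shows "measure (M \<Otimes>\<^sub>M M) {p\<in>space (M \<Otimes>\<^sub>M M). P (fst p) \<or> P (snd p)} = 1 - (1 - prob {\<omega>\<in>space M. P \<omega>}) ^ 2"
proof -
  interpret P: prob_space "M \<Otimes>\<^sub>M M" by (intro prob_space_pair prob_space_axioms)
  have "{p\<in>space (M \<Otimes>\<^sub>M M). P (fst p) \<or> P (snd p)} \<in> P.events" by measurable
  then have 1: "P.prob {p\<in>space (M \<Otimes>\<^sub>M M). \<not> (P (fst p) \<or> P (snd p))}
    = 1 - P.prob {p\<in>space (M \<Otimes>\<^sub>M M). P (fst p) \<or> P (snd p)}"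
    by (rule P.prob_neg)
  have 2: "P.prob {p\<in>space (M \<Otimes>\<^sub>M M). \<not> (P (fst p) \<or> P (snd p))} = prob {\<omega>\<in>space M. \<not> P \<omega>} ^ 2"
    unfolding de_Morgan_disj by (rule measure_pair_square) measurable
  have 3: "prob {\<omega>\<in>space M. \<not> P \<omega>} = 1 - prob {\<omega>\<in>space M. P \<omega>}"
    by (rule prob_neg) measurable
  show ?thesis using 1[unfolded 2 3] by linarith
qed

lemma AE_pair_both:
  assumes [measurable]: "Measurable.pred M P" and "AE \<omega> in M. P \<omega>"
  shows "AE p in M \<Otimes>\<^sub>M M. P (fst p) \<and> P (snd p)"
proof -
  interpret P: pair_prob_space M M ..
  have "AE x in M. AE y in M. P x \<and> P y"
    using assms(2) by eventually_elim (use assms(2) in simp)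
  then show ?thesis
    by (intro P.AE_pair_measure) auto
qed

lemma integrable_pair_components:
  fixes Z :: "'a \<Rightarrow> real"
  assumes "integrable M Z"
  shows "integrable (M \<Otimes>\<^sub>M M) (\<lambda>p. Z (fst p))" "integrable (M \<Otimes>\<^sub>M M) (\<lambda>p. Z (snd p))"
    "(\<integral>p. Z (fst p) \<partial>(M \<Otimes>\<^sub>M M)) = expectation Z" "(\<integral>p. Z (snd p) \<partial>(M \<Otimes>\<^sub>M M)) = expectation Z"
proof -
  interpret P: pair_prob_space M M ..
  have [measurable]: "Z \<in> borel_measurable M" using assms by auto
  have d1: "distr (M \<Otimes>\<^sub>M M) M fst = M"
    by (rule distr_pair_fst)
  \<comment> \<open>The second marginal is the first marginal of the swapped product.\<close>
  have d2: "distr (M \<Otimes>\<^sub>M M) M snd = M"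
    by (subst P.distr_pair_swap) (simp add: distr_distr comp_def split_beta distr_pair_fst)
  show "integrable (M \<Otimes>\<^sub>M M) (\<lambda>p. Z (fst p))" "integrable (M \<Otimes>\<^sub>M M) (\<lambda>p. Z (snd p))"
    using assms integrable_distr_eq[of fst "M \<Otimes>\<^sub>M M" M Z] integrable_distr_eq[of snd "M \<Otimes>\<^sub>M M" M Z]
    by (simp_all add: d1 d2)
  show "(\<integral>p. Z (fst p) \<partial>(M \<Otimes>\<^sub>M M)) = expectation Z" "(\<integral>p. Z (snd p) \<partial>(M \<Otimes>\<^sub>M M)) = expectation Z"
    using integral_distr[of fst "M \<Otimes>\<^sub>M M" M Z] integral_distr[of snd "M \<Otimes>\<^sub>M M" M Z]
    by (simp_all add: d1 d2)
qed

lemma integrable_pair_max_min: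
  fixes Z :: "'a \<Rightarrow> real"
  assumes "integrable M Z"
  shows "integrable (M \<Otimes>\<^sub>M M) (\<lambda>p. max (Z (fst p)) (Z (snd p)))"
    "integrable (M \<Otimes>\<^sub>M M) (\<lambda>p. min (Z (fst p)) (Z (snd p)))"
  using integrable_pair_components(1,2)[OF assms] by auto

lemma law_max2_distr:
  assumes [measurable]: "Z \<in> borel_measurable M"
  shows "law_max2 (distr M borel Z) = distr (M \<Otimes>\<^sub>M M) borel (\<lambda>p. max (Z (fst p)) (Z (snd p)))"
proof -
  interpret D: prob_space "distr M borel Z" by (rule prob_space_distr) simp
  show ?thesis
    unfolding law_max2_def
    by (subst pair_measure_distr)
       (auto simp: distr_distr D.sigma_finite_measure_axioms comp_def split_beta intro!: distr_cong)
qed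

lemma law_min2_distr:
  assumes [measurable]: "Z \<in> borel_measurable M"
  shows "law_min2 (distr M borel Z) = distr (M \<Otimes>\<^sub>M M) borel (\<lambda>p. min (Z (fst p)) (Z (snd p)))"
proof -
  interpret D: prob_space "distr M borel Z" by (rule prob_space_distr) simp
  show ?thesis
    unfolding law_min2_def
    by (subst pair_measure_distr)
       (auto simp: distr_distr D.sigma_finite_measure_axioms comp_def split_beta intro!: distr_cong)
qed

lemma mom1_max2_distr:
  assumes [measurable]: "Z \<in> borel_measurable M"
  shows "mom1 (law_max2 (distr M borel Z)) = (\<integral>p. max (Z (fst p)) (Z (snd p)) \<partial>(M \<Otimes>\<^sub>M M))"
  by (simp add: mom1_def law_max2_distr integral_distr)

lemma mom1_min2_distr:
  assumes [measurable]: "Z \<in> borel_measurable M"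
  shows "mom1 (law_min2 (distr M borel Z)) = (\<integral>p. min (Z (fst p)) (Z (snd p)) \<partial>(M \<Otimes>\<^sub>M M))"
  by (simp add: mom1_def law_min2_distr integral_distr)

text \<open>Squaring is monotone on the half line, so it commutes with the maximum. Second moments
  thereby become first moments of the squared variable, and the first-moment results apply to
  it.\<close>

lemma mom2_max2_distr:
  assumes [measurable]: "Z \<in> borel_measurable M" and pos: "AE \<omega> in M. 0 \<le> Z \<omega>"
  shows "mom2 (law_max2 (distr M borel Z)) = mom1 (law_max2 (distr M borel (\<lambda>\<omega>. Z \<omega> ^ 2)))"
proof -
  have pp: "AE p in M \<Otimes>\<^sub>M M. 0 \<le> Z (fst p) \<and> 0 \<le> Z (snd p)"
    by (rule AE_pair_both) (use pos in auto)
  have "AE p in M \<Otimes>\<^sub>M M. (max (Z (fst p)) (Z (snd p)))\<^sup>2 = max ((Z (fst p))\<^sup>2) ((Z (snd p))\<^sup>2)"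
    using pp by eventually_elim (auto simp: max_def abs_le_square_iff[symmetric])
  then show ?thesis
    by (auto simp: mom1_def mom2_def law_max2_distr integral_distr intro!: integral_cong_AE)
qed

lemma mom2_min2_distr:
  assumes [measurable]: "Z \<in> borel_measurable M" and pos: "AE \<omega> in M. 0 \<le> Z \<omega>"
  shows "mom2 (law_min2 (distr M borel Z)) = mom1 (law_min2 (distr M borel (\<lambda>\<omega>. Z \<omega> ^ 2)))"
proof -
  have pp: "AE p in M \<Otimes>\<^sub>M M. 0 \<le> Z (fst p) \<and> 0 \<le> Z (snd p)"
    by (rule AE_pair_both) (use pos in auto)
  have "AE p in M \<Otimes>\<^sub>M M. (min (Z (fst p)) (Z (snd p)))\<^sup>2 = min ((Z (fst p))\<^sup>2) ((Z (snd p))\<^sup>2)"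
    using pp by eventually_elim (auto simp: min_def abs_le_square_iff[symmetric])
  then show ?thesis
    by (auto simp: mom1_def mom2_def law_min2_distr integral_distr intro!: integral_cong_AE)
qed

text \<open>Rests on max + min = sum. It explains why squared means of maximum and minimum occur in
  the final formulas: their difference is twice the mean times the difference of the two
  means.\<close>

lemma mom1_max2_plus_min2:
  assumes "integrable M Z"
  shows "mom1 (law_max2 (distr M borel Z)) + mom1 (law_min2 (distr M borel Z)) = 2 * expectation Z"
proof -
  have [measurable]: "Z \<in> borel_measurable M" using assms by auto
  have "mom1 (law_max2 (distr M borel Z)) + mom1 (law_min2 (distr M borel Z))
    = (\<integral>p. max (Z (fst p)) (Z (snd p)) + min (Z (fst p)) (Z (snd p)) \<partial>(M \<Otimes>\<^sub>M M))"
    using integrable_pair_max_min[OF assms]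
    by (simp add: mom1_max2_distr mom1_min2_distr)
  also have "\<dots> = (\<integral>p. Z (fst p) + Z (snd p) \<partial>(M \<Otimes>\<^sub>M M))"
    by (intro Bochner_Integration.integral_cong) auto
  finally show ?thesis
    using integrable_pair_components[OF assms] by simp
qed

lemma has_bochner_integral_survival:
  assumes Z: "integrable M Z" and pos: "AE \<omega> in M. 0 \<le> Z \<omega>"
  shows "has_bochner_integral lborel
    (\<lambda>s. indicator {0..} s * (1 - prob {\<omega>\<in>space M. Z \<omega> \<le> s})) (expectation Z)"
proof -
  have [measurable]: "Z \<in> borel_measurable M" using Z by auto
  have "(\<integral>\<omega>. 1 * indicat_real {s<..} (Z \<omega>) \<partial>M) = 1 - prob {\<omega>\<in>space M. Z \<omega> \<le> s}" for s
  proof -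
    have "(\<integral>\<omega>. 1 * indicat_real {s<..} (Z \<omega>) \<partial>M) = (\<integral>\<omega>. indicator {\<omega>\<in>space M. s < Z \<omega>} \<omega> \<partial>M)"
      by (intro Bochner_Integration.integral_cong) (simp_all split: split_indicator)
    also have "\<dots> = prob {\<omega>\<in>space M. \<not> Z \<omega> \<le> s}"
      by (simp add: not_le)
    finally show ?thesis
      by (simp add: prob_neg)
  qed
  then show ?thesis
    using has_bochner_integral_layer_cake[of "\<lambda>_. 1" Z] Z pos by simp
qed

text \<open>The value is half the Gini mean difference E|Z - Z'| of two independent copies, because
  max - min = |Z - Z'|.\<close>

lemma has_bochner_integral_gini:
  assumes Z: "integrable M Z" and pos: "AE \<omega> in M. 0 \<le> Z \<omega>"
  shows "has_bochner_integral lborel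
    (\<lambda>s. indicator {0..} s * (prob {\<omega>\<in>space M. Z \<omega> \<le> s} * (1 - prob {\<omega>\<in>space M. Z \<omega> \<le> s})))
    ((mom1 (law_max2 (distr M borel Z)) - mom1 (law_min2 (distr M borel Z))) / 2)"
proof -
  interpret P: prob_space "M \<Otimes>\<^sub>M M" by (intro prob_space_pair prob_space_axioms)
  have [measurable]: "Z \<in> borel_measurable M" using Z by auto
  let ?F = "\<lambda>s. prob {\<omega>\<in>space M. Z \<omega> \<le> s}"
  have pp: "AE p in M \<Otimes>\<^sub>M M. 0 \<le> Z (fst p) \<and> 0 \<le> Z (snd p)"
    by (rule AE_pair_both) (use pos in auto)
  have mx: "P.prob {p\<in>space (M \<Otimes>\<^sub>M M). max (Z (fst p)) (Z (snd p)) \<le> s} = ?F s ^ 2" for s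
    using measure_pair_square[of "\<lambda>\<omega>. Z \<omega> \<le> s"] by simp
  have "1 - P.prob {p\<in>space (M \<Otimes>\<^sub>M M). min (Z (fst p)) (Z (snd p)) \<le> s} = (1 - ?F s) ^ 2" for s
    using measure_pair_square[of "\<lambda>\<omega>. \<not> Z \<omega> \<le> s"] by (simp add: P.prob_neg[symmetric] prob_neg de_Morgan_disj min_le_iff_disj)
  note mn = this
  have pmx: "AE p in M \<Otimes>\<^sub>M M. 0 \<le> max (Z (fst p)) (Z (snd p))"
    and pmn: "AE p in M \<Otimes>\<^sub>M M. 0 \<le> min (Z (fst p)) (Z (snd p))"
    using pp by (auto elim!: eventually_mono)
  have a: "has_bochner_integral lborel (\<lambda>s. indicator {0..} s * (1 - ?F s ^ 2))
      (mom1 (law_max2 (distr M borel Z)))"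
    using P.has_bochner_integral_survival[OF integrable_pair_max_min(1)[OF Z] pmx]
    unfolding mx by (simp add: mom1_max2_distr)
  have b: "has_bochner_integral lborel (\<lambda>s. indicator {0..} s * (1 - ?F s) ^ 2)
      (mom1 (law_min2 (distr M borel Z)))"
    using P.has_bochner_integral_survival[OF integrable_pair_max_min(2)[OF Z] pmn]
    unfolding mn by (simp add: mom1_min2_distr)
  have "has_bochner_integral lborel
     (\<lambda>s. (indicator {0..} s * (1 - ?F s ^ 2) - indicator {0..} s * (1 - ?F s) ^ 2) / 2)
     ((mom1 (law_max2 (distr M borel Z)) - mom1 (law_min2 (distr M borel Z))) / 2)"
    by (rule has_bochner_integral_divide, rule has_bochner_integral_diff) (rule a b)+
  also have "(\<lambda>s. (indicator {0..} s * (1 - ?F s ^ 2) - indicator {0..} s * (1 - ?F s) ^ 2) / 2)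
    = (\<lambda>s. indicator {0..} s * (?F s * (1 - ?F s)))"
    by (auto simp: power2_eq_square field_simps split: split_indicator)
  finally show ?thesis .
qed

section \<open>Moments on an event under FGM dependence\<close>

text \<open>The sign of \<open>c\<close> flips since the survival function on A is
  \<open>prob A\<close> minus the cdf on A, that is a(1 - F) - cF(1 - F). The two functions of s
  integrate to the mean and to half the Gini mean difference.\<close>

lemma expectation_indicator_fgm:
  fixes Z :: "'a \<Rightarrow> real"
  defines "F \<equiv> \<lambda>s. prob {\<omega>\<in>space M. Z \<omega> \<le> s}"
  assumes A [measurable]: "A \<in> events"
    and Z: "integrable M Z" "AE \<omega> in M. 0 \<le> Z \<omega>"
    and cdf: "\<And>s. 0 \<le> s \<Longrightarrow> prob {\<omega>\<in>A. Z \<omega> \<le> s} = a * F s + c * (F s * (1 - F s))"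
    and a: "prob A = a"
  shows "(\<integral>\<omega>. indicator A \<omega> * Z \<omega> \<partial>M) = a * expectation Z
    - c * ((mom1 (law_max2 (distr M borel Z)) - mom1 (law_min2 (distr M borel Z))) / 2)"
proof -
  have [measurable]: "Z \<in> borel_measurable M" using Z by auto
  have A': "A \<subseteq> space M" using sets.sets_into_space[OF A] .
  have surv: "(\<integral>\<omega>. indicator A \<omega> * indicator {s<..} (Z \<omega>) \<partial>M) = a * (1 - F s) - c * (F s * (1 - F s))"
    if "0 \<le> s" for s
  proof -
    have "(\<integral>\<omega>. indicator A \<omega> * indicator {s<..} (Z \<omega>) \<partial>M)
      = (\<integral>\<omega>. indicator A \<omega> - indicator {\<omega>\<in>A. Z \<omega> \<le> s} \<omega> \<partial>M :: real)"
      by (intro Bochner_Integration.integral_cong) (auto split: split_indicator)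
    also have "\<dots> = prob A - prob {\<omega>\<in>A. Z \<omega> \<le> s}"
      using A' by (subst Bochner_Integration.integral_diff) (auto simp: emeasure_eq_measure Int_absorb2 Int_absorb1 intro!: arg_cong[where f = prob])
    finally show ?thesis
      using cdf[OF that] a by (simp add: algebra_simps)
  qed
  have int: "integrable M (\<lambda>\<omega>. indicator A \<omega> * Z \<omega>)"
    using integrable_mult_indicator[OF A Z(1)] by simp
  have "has_bochner_integral lborel
    (\<lambda>s. indicator {0..} s * (\<integral>\<omega>. indicator A \<omega> * indicator {s<..} (Z \<omega>) \<partial>M)) (\<integral>\<omega>. indicator A \<omega> * Z \<omega> \<partial>M)"
    by (rule has_bochner_integral_layer_cake)
       (use int Z in \<open>auto intro!: integrable_real_indicator simp: emeasure_eq_measure\<close>)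
  also have "(\<lambda>s. indicator {0..} s * (\<integral>\<omega>. indicator A \<omega> * indicator {s<..} (Z \<omega>) \<partial>M))
    = (\<lambda>s. a * (indicator {0..} s * (1 - F s)) - c * (indicator {0..} s * (F s * (1 - F s))))"
    using surv by (auto simp: fun_eq_iff split: split_indicator)
  finally have 1: "has_bochner_integral lborel
    (\<lambda>s. a * (indicator {0..} s * (1 - F s)) - c * (indicator {0..} s * (F s * (1 - F s))))
    (\<integral>\<omega>. indicator A \<omega> * Z \<omega> \<partial>M)" .
  have 2: "has_bochner_integral lborel
    (\<lambda>s. a * (indicator {0..} s * (1 - F s)) - c * (indicator {0..} s * (F s * (1 - F s))))
    (a * expectation Z
    - c * ((mom1 (law_max2 (distr M borel Z)) - mom1 (law_min2 (distr M borel Z))) / 2))"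
    unfolding F_def
    by (intro has_bochner_integral_diff has_bochner_integral_mult_right
      has_bochner_integral_survival has_bochner_integral_gini Z)
  show ?thesis by (rule has_bochner_integral_eq[OF 1 2])
qed

text \<open>The joint survival function on A is bilinear in the pairs (1 - F, F(1 - F)) and (1 - G,
  G(1 - G)), with coefficients a, -c, -c, e. Integrating in both variables replaces the pairs by
  (E[Y], \<open>dY\<close>) and (E[Z], \<open>dZ\<close>).\<close>

lemma expectation_indicator_prod_fgm:
  fixes Y Z :: "'a \<Rightarrow> real"
  defines "F \<equiv> \<lambda>s. prob {\<omega>\<in>space M. Y \<omega> \<le> s}" and "G \<equiv> \<lambda>t. prob {\<omega>\<in>space M. Z \<omega> \<le> t}"
  defines "dY \<equiv> (mom1 (law_max2 (distr M borel Y)) - mom1 (law_min2 (distr M borel Y))) / 2"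
    and "dZ \<equiv> (mom1 (law_max2 (distr M borel Z)) - mom1 (law_min2 (distr M borel Z))) / 2"
  assumes A [measurable]: "A \<in> events" and a: "prob A = a"
    and Y: "integrable M Y" "AE \<omega> in M. 0 \<le> Y \<omega>"
    and Z: "integrable M Z" "AE \<omega> in M. 0 \<le> Z \<omega>"
    and YZ: "integrable M (\<lambda>\<omega>. Y \<omega> * Z \<omega>)"
    and cdfY: "\<And>s. prob {\<omega>\<in>A. Y \<omega> \<le> s} = a * F s + c * (F s * (1 - F s))"
    and cdfZ: "\<And>t. prob {\<omega>\<in>A. Z \<omega> \<le> t} = a * G t + c * (G t * (1 - G t))"
    and cdf: "\<And>s t. prob {\<omega>\<in>A. Y \<omega> \<le> s \<and> Z \<omega> \<le> t}
      = F s * G t * (a + c * ((1 - F s) + (1 - G t)) + e * ((1 - F s) * (1 - G t)))"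
  shows "(\<integral>\<omega>. indicator A \<omega> * (Y \<omega> * Z \<omega>) \<partial>M)
    = a * expectation Y * expectation Z - c * (dY * expectation Z + expectation Y * dZ) + e * dY * dZ"
proof -
  have [measurable]: "Z \<in> borel_measurable M" "Y \<in> borel_measurable M" using Z Y by auto
  \<comment> \<open>Inclusion-exclusion in the two thresholds; the result is grouped by its
    dependence on \<open>t\<close>, the variable integrated first.\<close>
  have surv: "(\<integral>\<omega>. indicator A \<omega> * indicator {s<..} (Y \<omega>) * indicator {t<..} (Z \<omega>) \<partial>M)
    = (a * (1 - F s) - c * (F s * (1 - F s))) * (1 - G t)
      + (e * (F s * (1 - F s)) - c * (1 - F s)) * (G t * (1 - G t))" for s t
  proof -
    have "(\<integral>\<omega>. indicator A \<omega> * indicator {s<..} (Y \<omega>) * indicator {t<..} (Z \<omega>) \<partial>M)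
      = (\<integral>\<omega>. (indicator A \<omega> - indicator {\<omega>\<in>A. Y \<omega> \<le> s} \<omega>)
          - (indicator {\<omega>\<in>A. Z \<omega> \<le> t} \<omega> - indicator {\<omega>\<in>A. Y \<omega> \<le> s \<and> Z \<omega> \<le> t} \<omega>) \<partial>M :: real)"
      by (intro Bochner_Integration.integral_cong) (auto split: split_indicator)
    also have "\<dots> = (prob A - prob {\<omega>\<in>A. Y \<omega> \<le> s})
      - (prob {\<omega>\<in>A. Z \<omega> \<le> t} - prob {\<omega>\<in>A. Y \<omega> \<le> s \<and> Z \<omega> \<le> t})"
    proof -
      have i: "has_bochner_integral M (indicat_real B) (prob B)" if "B \<in> events" for B
        using that by (intro has_bochner_integral_real_indicator) (auto simp: emeasure_eq_measure)
      show ?thesis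
        by (intro has_bochner_integral_integral_eq has_bochner_integral_diff i) simp_all
    qed
    finally show ?thesis
      unfolding cdf cdfY cdfZ a by (simp add: algebra_simps)
  qed
  have int: "integrable M (\<lambda>\<omega>. indicator A \<omega> * Z \<omega>)"
    using integrable_mult_indicator[OF A Z(1)] by simp
  have ind: "integrable M (\<lambda>\<omega>. indicator A \<omega> * indicat_real {s<..} (Y \<omega>))" for s
    by (rule integrable_const_bound[where B = 1]) (auto split: split_indicator)
  have inner: "(\<integral>\<omega>. indicator A \<omega> * Z \<omega> * indicator {s<..} (Y \<omega>) \<partial>M)
      = (a * (1 - F s) - c * (F s * (1 - F s))) * expectation Z
      + (e * (F s * (1 - F s)) - c * (1 - F s)) * dZ" for s
  proof -
    have int': "integrable M (\<lambda>\<omega>. indicator A \<omega> * indicator {s<..} (Y \<omega>) * Z \<omega>)"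
      by (rule Bochner_Integration.integrable_bound[OF Z(1)]) (auto split: split_indicator)
    have "has_bochner_integral lborel (\<lambda>t. indicator {0..} t *
        (\<integral>\<omega>. indicator A \<omega> * indicator {s<..} (Y \<omega>) * indicator {t<..} (Z \<omega>) \<partial>M))
        (\<integral>\<omega>. indicator A \<omega> * indicator {s<..} (Y \<omega>) * Z \<omega> \<partial>M)"
      by (rule has_bochner_integral_layer_cake) (use int' Z ind in auto)
    also have "(\<lambda>t. indicator {0..} t *
        (\<integral>\<omega>. indicator A \<omega> * indicator {s<..} (Y \<omega>) * indicator {t<..} (Z \<omega>) \<partial>M))
      = (\<lambda>t. (a * (1 - F s) - c * (F s * (1 - F s))) * (indicator {0..} t * (1 - G t))
          + (e * (F s * (1 - F s)) - c * (1 - F s)) * (indicator {0..} t * (G t * (1 - G t))))"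
      unfolding surv by (auto simp: fun_eq_iff split: split_indicator)
    finally have 1: "has_bochner_integral lborel
      (\<lambda>t. (a * (1 - F s) - c * (F s * (1 - F s))) * (indicator {0..} t * (1 - G t))
          + (e * (F s * (1 - F s)) - c * (1 - F s)) * (indicator {0..} t * (G t * (1 - G t))))
        (\<integral>\<omega>. indicator A \<omega> * indicator {s<..} (Y \<omega>) * Z \<omega> \<partial>M)" .
    have 2: "has_bochner_integral lborel
      (\<lambda>t. (a * (1 - F s) - c * (F s * (1 - F s))) * (indicator {0..} t * (1 - G t))
          + (e * (F s * (1 - F s)) - c * (1 - F s)) * (indicator {0..} t * (G t * (1 - G t))))
      ((a * (1 - F s) - c * (F s * (1 - F s))) * expectation Z
      + (e * (F s * (1 - F s)) - c * (1 - F s)) * dZ)"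
      unfolding G_def dZ_def
      by (intro has_bochner_integral_add has_bochner_integral_mult_right
        has_bochner_integral_survival has_bochner_integral_gini Z)
    show ?thesis
      using has_bochner_integral_eq[OF 1 2] by (simp add: ac_simps)
  qed
  have int2: "integrable M (\<lambda>\<omega>. indicator A \<omega> * Z \<omega> * Y \<omega>)"
    using integrable_mult_indicator[OF A YZ] by (simp add: ac_simps)
  \<comment> \<open>Second pass: \<open>indicator A \<omega> * Z \<omega>\<close> is now the weight,
    and by \<open>inner\<close> its integral above the level \<open>s\<close> of Y is again a
    combination of 1 - F and F(1 - F).\<close>
  have "has_bochner_integral lborel (\<lambda>s. indicator {0..} s *
      (\<integral>\<omega>. indicator A \<omega> * Z \<omega> * indicator {s<..} (Y \<omega>) \<partial>M)) (\<integral>\<omega>. indicator A \<omega> * Z \<omega> * Y \<omega> \<partial>M)"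
    by (rule has_bochner_integral_layer_cake) (use int2 int Y Z in auto)
  also have "(\<lambda>s. indicator {0..} s * (\<integral>\<omega>. indicator A \<omega> * Z \<omega> * indicator {s<..} (Y \<omega>) \<partial>M))
    = (\<lambda>s. (a * expectation Z - c * dZ) * (indicator {0..} s * (1 - F s))
        + (e * dZ - c * expectation Z) * (indicator {0..} s * (F s * (1 - F s))))"
    unfolding inner by (auto simp: fun_eq_iff algebra_simps split: split_indicator)
  finally have 1: "has_bochner_integral lborel
    (\<lambda>s. (a * expectation Z - c * dZ) * (indicator {0..} s * (1 - F s))
        + (e * dZ - c * expectation Z) * (indicator {0..} s * (F s * (1 - F s))))
      (\<integral>\<omega>. indicator A \<omega> * Z \<omega> * Y \<omega> \<partial>M)" .
  have 2: "has_bochner_integral lborel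
    (\<lambda>s. (a * expectation Z - c * dZ) * (indicator {0..} s * (1 - F s))
        + (e * dZ - c * expectation Z) * (indicator {0..} s * (F s * (1 - F s))))
    ((a * expectation Z - c * dZ) * expectation Y + (e * dZ - c * expectation Z) * dY)"
    unfolding F_def dY_def
    by (intro has_bochner_integral_add has_bochner_integral_mult_right
      has_bochner_integral_survival has_bochner_integral_gini Y)
  show ?thesis
    using has_bochner_integral_eq[OF 1 2] by (simp add: algebra_simps)
qed

section \<open>The ratio of the order-statistics pmfs\<close>

lemma gammaN_eq_diff:
  assumes [measurable]: "N \<in> measurable M (count_space UNIV)"
  shows "gammaN M N n = prob {\<omega>\<in>space M. N \<omega> \<le> n} - prob {\<omega>\<in>space M. N \<omega> < n}"
proof -
  have e: "{\<omega>\<in>space M. N \<omega> = n} = {\<omega>\<in>space M. N \<omega> \<le> n} - {\<omega>\<in>space M. N \<omega> < n}" by auto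
  show ?thesis
    unfolding gammaN_def e by (rule finite_measure_Diff) (measurable, auto)
qed

text \<open>Realises the maximum as a counting variable on the product space, so that the results on
  \<open>gammaN\<close>, valid in every probability space, apply to it.\<close>

lemma gammaN2_eq_gammaN:
  assumes [measurable]: "N \<in> measurable M (count_space UNIV)"
  shows "gammaN2 M N n = gammaN (M \<Otimes>\<^sub>M M) (\<lambda>p. max (N (fst p)) (N (snd p))) n"
proof -
  have "(\<lambda>p. max (real (N (fst p))) (real (N (snd p)))) -` {real n} \<inter> space (M \<Otimes>\<^sub>M M)
    = {p \<in> space (M \<Otimes>\<^sub>M M). max (N (fst p)) (N (snd p)) = n}"
    by (auto simp: max_def)
  then show ?thesis
    unfolding gammaN2_def lawN_def gammaN_def
    by (subst law_max2_distr) (simp_all add: measure_distr)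
qed

lemma gammaN1_eq_gammaN:
  assumes [measurable]: "N \<in> measurable M (count_space UNIV)"
  shows "gammaN1 M N n = gammaN (M \<Otimes>\<^sub>M M) (\<lambda>p. min (N (fst p)) (N (snd p))) n"
proof -
  have "(\<lambda>p. min (real (N (fst p))) (real (N (snd p)))) -` {real n} \<inter> space (M \<Otimes>\<^sub>M M)
    = {p \<in> space (M \<Otimes>\<^sub>M M). min (N (fst p)) (N (snd p)) = n}"
    by (auto simp: min_def)
  then show ?thesis
    unfolding gammaN1_def lawN_def gammaN_def
    by (subst law_min2_distr) (simp_all add: measure_distr)
qed

lemma gammaN2_eq:
  assumes [measurable]: "N \<in> measurable M (count_space UNIV)"
  shows "gammaN2 M N n = prob {\<omega>\<in>space M. N \<omega> \<le> n} ^ 2 - prob {\<omega>\<in>space M. N \<omega> < n} ^ 2"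
proof -
  interpret P: prob_space "M \<Otimes>\<^sub>M M" by (intro prob_space_pair prob_space_axioms)
  show ?thesis
    unfolding gammaN2_eq_gammaN[OF assms]
    using measure_pair_square[of "\<lambda>\<omega>. N \<omega> \<le> n"] measure_pair_square[of "\<lambda>\<omega>. N \<omega> < n"]
    by (subst P.gammaN_eq_diff) simp_all
qed

lemma gammaN1_eq:
  assumes [measurable]: "N \<in> measurable M (count_space UNIV)"
  shows "gammaN1 M N n = (1 - prob {\<omega>\<in>space M. N \<omega> < n}) ^ 2 - (1 - prob {\<omega>\<in>space M. N \<omega> \<le> n}) ^ 2"
proof -
  interpret P: prob_space "M \<Otimes>\<^sub>M M" by (intro prob_space_pair prob_space_axioms)
  have le: "P.prob {p \<in> space (M \<Otimes>\<^sub>M M). min (N (fst p)) (N (snd p)) \<le> n}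
      = 1 - (1 - prob {\<omega>\<in>space M. N \<omega> \<le> n}) ^ 2"
    unfolding min_le_iff_disj by (rule measure_pair_disj) measurable
  have lt: "P.prob {p \<in> space (M \<Otimes>\<^sub>M M). min (N (fst p)) (N (snd p)) < n}
      = 1 - (1 - prob {\<omega>\<in>space M. N \<omega> < n}) ^ 2"
    unfolding min_less_iff_disj by (rule measure_pair_disj) measurable
  have "P.random_variable (count_space UNIV) (\<lambda>p. min (N (fst p)) (N (snd p)))"
    by measurable
  then have "gammaN1 M N n = (1 - (1 - prob {\<omega>\<in>space M. N \<omega> \<le> n}) ^ 2) - (1 - (1 - prob {\<omega>\<in>space M. N \<omega> < n}) ^ 2)"
    unfolding gammaN1_eq_gammaN[OF assms] le[symmetric] lt[symmetric] by (rule P.gammaN_eq_diff)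
  then show ?thesis by linarith
qed

text \<open>With x = P(N \<le> n) and y = P(N < n), the left side is 2(x - y)(x + y - 1) and x - y
  is \<open>gammaN\<close>. So the difference vanishes wherever \<open>gammaN\<close> does, and
  their quotient is bounded.\<close>

lemma gamma_diff_eq:
  assumes "N \<in> measurable M (count_space UNIV)"
  shows "gammaN2 M N n - gammaN1 M N n
    = 2 * gammaN M N n * (prob {\<omega>\<in>space M. N \<omega> \<le> n} + prob {\<omega>\<in>space M. N \<omega> < n} - 1)"
  unfolding gammaN2_eq[OF assms] gammaN1_eq[OF assms] gammaN_eq_diff[OF assms]
  by (simp add: algebra_simps power2_eq_square)

lemma abs_Rratio_le:
  assumes "N \<in> measurable M (count_space UNIV)"
  shows "\<bar>Rratio M N n\<bar> \<le> 2"
proof -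
  have "\<bar>2 * (x + y - 1)\<bar> \<le> 2" if "0 \<le> x" "x \<le> 1" "0 \<le> y" "y \<le> 1" for x y :: real
    using that by (auto simp: abs_le_iff)
  then have "\<bar>2 * (prob {\<omega>\<in>space M. N \<omega> \<le> n} + prob {\<omega>\<in>space M. N \<omega> < n} - 1)\<bar> \<le> 2"
    by this simp_all
  then show ?thesis
    unfolding Rratio_def gamma_diff_eq[OF assms] by (cases "gammaN M N n = 0") auto
qed

text \<open>Valid off the support too, where \<open>Rratio\<close> is 0 by division by zero and the
  right side is 0 by \<open>gamma_diff_eq\<close>.\<close>

lemma gammaN_times_Rratio:
  assumes "N \<in> measurable M (count_space UNIV)"
  shows "gammaN M N n * Rratio M N n = gammaN2 M N n - gammaN1 M N n"
  unfolding Rratio_def gamma_diff_eq[OF assms] by simp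

lemma max2_lawN_sums:
  assumes [measurable]: "N \<in> measurable M (count_space UNIV)"
    and int: "integrable M (\<lambda>\<omega>. real (N \<omega>) ^ p)"
  shows "(\<lambda>n. gammaN2 M N n * real n ^ p) sums (\<integral>x. x ^ p \<partial>law_max2 (lawN M N))"
proof -
  interpret P: prob_space "M \<Otimes>\<^sub>M M" by (intro prob_space_pair prob_space_axioms)
  have [measurable]: "(\<lambda>q. max (N (fst q)) (N (snd q))) \<in> measurable (M \<Otimes>\<^sub>M M) (count_space UNIV)"
    by measurable
  \<comment> \<open>The sum of the two powers dominates the power of the maximum.\<close>
  have "integrable (M \<Otimes>\<^sub>M M) (\<lambda>q. real (N (fst q)) ^ p + real (N (snd q)) ^ p)"
    using integrable_pair_components(1,2)[OF int] by (rule Bochner_Integration.integrable_add)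
  then have "integrable (M \<Otimes>\<^sub>M M) (\<lambda>q. real (max (N (fst q)) (N (snd q))) ^ p)"
    by (rule Bochner_Integration.integrable_bound) (measurable, simp add: max_def)
  then have "(\<lambda>n. gammaN2 M N n * real n ^ p) sums (\<integral>q. real (max (N (fst q)) (N (snd q))) ^ p \<partial>(M \<Otimes>\<^sub>M M))"
    unfolding gammaN2_eq_gammaN[OF assms(1)]
    by (intro P.expectation_gammaN_sums[where h = "\<lambda>n. real n ^ p"]) measurable
  also have "(\<integral>q. real (max (N (fst q)) (N (snd q))) ^ p \<partial>(M \<Otimes>\<^sub>M M)) = (\<integral>x. x ^ p \<partial>law_max2 (lawN M N))"
    unfolding lawN_def by (subst law_max2_distr) (simp_all add: integral_distr of_nat_max)
  finally show ?thesis .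
qed

lemma min2_lawN_sums:
  assumes [measurable]: "N \<in> measurable M (count_space UNIV)"
    and int: "integrable M (\<lambda>\<omega>. real (N \<omega>) ^ p)"
  shows "(\<lambda>n. gammaN1 M N n * real n ^ p) sums (\<integral>x. x ^ p \<partial>law_min2 (lawN M N))"
proof -
  interpret P: prob_space "M \<Otimes>\<^sub>M M" by (intro prob_space_pair prob_space_axioms)
  have [measurable]: "(\<lambda>q. min (N (fst q)) (N (snd q))) \<in> measurable (M \<Otimes>\<^sub>M M) (count_space UNIV)"
    by measurable
  have "integrable (M \<Otimes>\<^sub>M M) (\<lambda>q. real (N (fst q)) ^ p + real (N (snd q)) ^ p)"
    using integrable_pair_components(1,2)[OF int] by (rule Bochner_Integration.integrable_add)
  then have "integrable (M \<Otimes>\<^sub>M M) (\<lambda>q. real (min (N (fst q)) (N (snd q))) ^ p)"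
    by (rule Bochner_Integration.integrable_bound) (measurable, simp add: min_def)
  then have "(\<lambda>n. gammaN1 M N n * real n ^ p) sums (\<integral>q. real (min (N (fst q)) (N (snd q))) ^ p \<partial>(M \<Otimes>\<^sub>M M))"
    unfolding gammaN1_eq_gammaN[OF assms(1)]
    by (intro P.expectation_gammaN_sums[where h = "\<lambda>n. real n ^ p"]) measurable
  also have "(\<integral>q. real (min (N (fst q)) (N (snd q))) ^ p \<partial>(M \<Otimes>\<^sub>M M)) = (\<integral>x. x ^ p \<partial>law_min2 (lawN M N))"
    unfolding lawN_def by (subst law_min2_distr) (simp_all add: integral_distr of_nat_min)
  finally show ?thesis .
qed

lemma integrable_power_times_Rratio:
  assumes [measurable]: "N \<in> measurable M (count_space UNIV)"
    and int: "integrable M (\<lambda>\<omega>. real (N \<omega>) ^ p)"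
  shows "integrable M (\<lambda>\<omega>. real (N \<omega>) ^ p * Rratio M N (N \<omega>) ^ q)"
proof (rule Bochner_Integration.integrable_bound)
  show "integrable M (\<lambda>\<omega>. real (N \<omega>) ^ p * 2 ^ q)" using int by simp
  show "AE \<omega> in M. norm (real (N \<omega>) ^ p * Rratio M N (N \<omega>) ^ q) \<le> norm (real (N \<omega>) ^ p * 2 ^ q)"
    using abs_Rratio_le[OF assms(1)]
    by (auto simp: abs_mult power_abs intro!: mult_left_mono power_mono)
qed simp

text \<open>R is the density of the signed measure with weights \<open>gammaN2\<close> -
  \<open>gammaN1\<close> relative to the law of N, so one factor R turns a moment of N into the
  difference of that moment between maximum and minimum.\<close>

lemma expectation_power_times_Rratio:
  assumes "N \<in> measurable M (count_space UNIV)"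
    and int: "integrable M (\<lambda>\<omega>. real (N \<omega>) ^ p)"
  shows "expectation (\<lambda>\<omega>. real (N \<omega>) ^ p * Rratio M N (N \<omega>))
    = (\<integral>x. x ^ p \<partial>law_max2 (lawN M N)) - (\<integral>x. x ^ p \<partial>law_min2 (lawN M N))"
proof -
  have "(\<lambda>n. gammaN M N n * (real n ^ p * Rratio M N n)) sums expectation (\<lambda>\<omega>. real (N \<omega>) ^ p * Rratio M N (N \<omega>))"
    using expectation_gammaN_sums[OF assms(1), of "\<lambda>n. real n ^ p * Rratio M N n"]
      integrable_power_times_Rratio[OF assms, of 1] by simp
  moreover have "gammaN M N n * (real n ^ p * Rratio M N n)
      = gammaN2 M N n * real n ^ p - gammaN1 M N n * real n ^ p" for n
    using gammaN_times_Rratio[OF assms(1), of n] by (simp add: mult.left_commute[of _ "real n ^ p"] left_diff_distrib[symmetric])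
  ultimately show ?thesis
    using sums_diff[OF max2_lawN_sums[OF assms] min2_lawN_sums[OF assms]]
    by (auto dest: sums_unique2)
qed

end

section \<open>The collective risk model\<close>

lemma sum_Pow_insert:
  fixes h :: "'b set \<Rightarrow> 'c::comm_monoid_add"
  assumes "finite A" "a \<notin> A"
  shows "(\<Sum>S\<in>Pow (insert a A). h S) = (\<Sum>S\<in>Pow A. h S) + (\<Sum>S\<in>Pow A. h (insert a S))"
proof -
  have "inj_on (insert a) (Pow A)"
    using assms(2) by (auto simp: inj_on_def insert_ident subset_iff)
  then have "(\<Sum>S\<in>insert a ` Pow A. h S) = (\<Sum>S\<in>Pow A. h (insert a S))"
    by (simp add: sum.reindex)
  then show ?thesis
    using assms unfolding Pow_insert by (subst sum.union_disjoint) auto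
qed

text \<open>With the condition on \<open>card\<close> moved into the summand, the sum runs over a
  full power set, which \<open>sum_Pow_insert\<close> unrolls one coordinate at a time for a
  concrete index set.\<close>

lemma fgm_copula_eq_sum_Pow:
  assumes "finite I"
  shows "fgm_copula I t u = (\<Prod>m\<in>I. u m)
    * (1 + (\<Sum>S\<in>Pow I. if 2 \<le> card S then t S * (\<Prod>j\<in>S. 1 - u j) else 0))"
proof -
  have "{S. S \<subseteq> I \<and> 2 \<le> card S} = {S \<in> Pow I. 2 \<le> card S}" by auto
  then show ?thesis
    unfolding fgm_copula_def using assms by (simp only: sum.inter_filter finite_Pow_iff)
qed

lemma fgm_copula_01:
  "fgm_copula {0..1} t u = u 0 * u 1 * (1 + t {0, 1} * ((1 - u 0) * (1 - u 1)))"
proof -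
  have I: "{0..1::nat} = {0, 1}" by auto
  show ?thesis unfolding I by (simp add: fgm_copula_eq_sum_Pow sum_Pow_insert)
qed

lemma fgm_copula_012:
  "fgm_copula {0..2} t u = u 0 * u 1 * u 2 * (1 + t {0, 1} * ((1 - u 0) * (1 - u 1))
     + t {0, 2} * ((1 - u 0) * (1 - u 2)) + t {1, 2} * ((1 - u 1) * (1 - u 2))
     + t {0, 1, 2} * ((1 - u 0) * (1 - u 1) * (1 - u 2)))"
proof -
  have I: "{0..2::nat} = {0, 1, 2}" by auto
  show ?thesis unfolding I by (simp add: fgm_copula_eq_sum_Pow sum_Pow_insert) 
qed

locale fgm_collective_risk = prob_space M
  for M :: "'a measure" +
  fixes N :: "'a \<Rightarrow> nat" and X :: "nat \<Rightarrow> 'a \<Rightarrow> real"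
    and \<theta> :: "nat \<Rightarrow> nat set \<Rightarrow> real" and \<theta>01 \<theta>12 \<theta>012 :: real
  assumes crm: "CRM M N X"
    and fgm: "in_FGM_star M N X \<theta>"
    and par01: "\<And>k j. crm_index M N k \<Longrightarrow> j \<in> {1..k} \<Longrightarrow> \<theta> k {0, j} = \<theta>01"
    and par12: "\<And>k i j. crm_index M N k \<Longrightarrow> 1 \<le> i \<Longrightarrow> i < j \<Longrightarrow> j \<le> k \<Longrightarrow> \<theta> k {i, j} = \<theta>12"
    and par012: "\<And>k i j. crm_index M N k \<Longrightarrow> 1 \<le> i \<Longrightarrow> i < j \<Longrightarrow> j \<le> k \<Longrightarrow> \<theta> k {0, i, j} = \<theta>012"
    and intN1: "integrable M (\<lambda>\<omega>. real (N \<omega>))"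
    and intN2: "integrable M (\<lambda>\<omega>. real (N \<omega>) ^ 2)"
    and intX1: "integrable M (X 1)"
    and intX2: "integrable M (\<lambda>\<omega>. X 1 \<omega> ^ 2)"
begin

section \<open>Measurability, integrability and the support of N\<close>

lemma N_measurable [measurable]: "N \<in> measurable M (count_space UNIV)"
  using crm by (simp add: CRM_def)

lemma X_measurable: "1 \<le> j \<Longrightarrow> X j \<in> borel_measurable M"
  using crm by (simp add: CRM_def)

lemma X12_measurable [measurable]: "X 1 \<in> borel_measurable M" "X 2 \<in> borel_measurable M"
  by (simp_all add: X_measurable)

lemma X_nonneg: "1 \<le> j \<Longrightarrow> AE \<omega> in M. 0 \<le> X j \<omega>"
  using crm by (auto simp: CRM_def elim!: eventually_mono)

lemma X_distr: "1 \<le> j \<Longrightarrow> distr M borel (X j) = distr M borel (X 1)"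
  using crm unfolding CRM_def by blast

lemma integrable_X:
  assumes "1 \<le> j"
  shows "integrable M (X j)" "integrable M (\<lambda>\<omega>. X j \<omega> ^ 2)"
proof -
  have "integrable M (\<lambda>\<omega>. f (X j \<omega>))" if "f \<in> borel_measurable borel" "integrable M (\<lambda>\<omega>. f (X 1 \<omega>))"
    for f :: "real \<Rightarrow> real"
    unfolding integrable_distr_eq[OF X_measurable[OF assms] that(1), symmetric] X_distr[OF assms]
    unfolding integrable_distr_eq[OF X12_measurable(1) that(1)] by (rule that(2))
  from this[of "\<lambda>x. x", OF _ intX1] this[of "\<lambda>x. x ^ 2", OF _ intX2]
  show "integrable M (X j)" "integrable M (\<lambda>\<omega>. X j \<omega> ^ 2)"
    by simp_all
qed

lemma integrable_X_times_X:
  assumes "1 \<le> i" "1 \<le> j"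
  shows "integrable M (\<lambda>\<omega>. X i \<omega> * X j \<omega>)"
proof (rule Bochner_Integration.integrable_bound)
  show "integrable M (\<lambda>\<omega>. X i \<omega> ^ 2 + X j \<omega> ^ 2)"
    using assms by (intro Bochner_Integration.integrable_add integrable_X)
  show "(\<lambda>\<omega>. X i \<omega> * X j \<omega>) \<in> borel_measurable M"
    using assms by (intro borel_measurable_times X_measurable)
  have "\<bar>x * y\<bar> \<le> x ^ 2 + y ^ 2" for x y :: real
  proof -
    have "2 * (\<bar>x\<bar> * \<bar>y\<bar>) \<le> x ^ 2 + y ^ 2"
      using sum_squares_bound[of "\<bar>x\<bar>" "\<bar>y\<bar>"] by (simp add: mult.assoc)
    moreover have "0 \<le> \<bar>x\<bar> * \<bar>y\<bar>" by simp
    ultimately show ?thesis unfolding abs_mult by linarith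
  qed
  then show "AE \<omega> in M. norm (X i \<omega> * X j \<omega>) \<le> norm (X i \<omega> ^ 2 + X j \<omega> ^ 2)"
    by simp
qed

lemma integrable_indicator_times:
  "integrable M Z \<Longrightarrow> integrable M (\<lambda>\<omega>. indicator {\<omega>\<in>space M. N \<omega> = n} \<omega> * (Z \<omega> :: real))"
  using integrable_mult_indicator[of "{\<omega>\<in>space M. N \<omega> = n}" M Z] by simp

lemma crm_index_if: "gammaN M N n > 0 \<Longrightarrow> 1 \<le> k \<Longrightarrow> k \<le> n \<Longrightarrow> crm_index M N k"
  unfolding crm_index_def by auto

text \<open>Values off the support give countably many null events. Identities in N can thus be
  checked pointwise at values where the copula and exchangeability hypotheses are available.\<close>

lemma AE_gammaN_pos: "AE \<omega> in M. gammaN M N (N \<omega>) > 0"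
proof -
  have "AE \<omega> in M. N \<omega> = n \<longrightarrow> gammaN M N n > 0" for n
  proof (cases "gammaN M N n = 0")
    case True
    then have "AE \<omega> in M. \<omega> \<notin> {\<omega>\<in>space M. N \<omega> = n}"
      unfolding gammaN_def by (subst prob_eq_0[symmetric]) auto
    with AE_space show ?thesis by eventually_elim auto
  next
    case False
    then have "gammaN M N n > 0" using gammaN_nonneg[of N n] by linarith
    then show ?thesis by simp
  qed
  then have "AE \<omega> in M. \<forall>n. N \<omega> = n \<longrightarrow> gammaN M N n > 0"
    by (subst AE_all_countable) auto
  then show ?thesis by simp
qed

text \<open>Undoes the division in \<open>cexp\<close> also when \<open>gammaN\<close> is 0: the
  event is then null and both sides vanish.\<close>

lemma integral_indicator_eq_cexp:
  fixes Z :: "'a \<Rightarrow> real"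
  shows "(\<integral>\<omega>. indicator {\<omega>\<in>space M. N \<omega> = n} \<omega> * Z \<omega> \<partial>M) = gammaN M N n * cexp M N Z n"
proof (cases "gammaN M N n = 0")
  case True
  have "AE \<omega> in M. indicator {\<omega>\<in>space M. N \<omega> = n} \<omega> * Z \<omega> = 0"
    using AE_gammaN_pos by eventually_elim (use True in \<open>auto split: split_indicator\<close>)
  then have "(\<integral>\<omega>. indicator {\<omega>\<in>space M. N \<omega> = n} \<omega> * Z \<omega> \<partial>M) = 0"
    by (rule integral_eq_zero_AE)
  with True show ?thesis by simp
qed (simp add: cexp_def)

section \<open>Exchangeability of the claims given N\<close>

text \<open>Equality of the two vector laws is tested on the function \<open>?f\<close>, which
  selects N = n through coordinate 0 and applies \<open>h\<close> to coordinates i and j. Taking j =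
  i covers functions of a single claim.\<close>

lemma cexp_exchange:
  fixes h :: "real \<times> real \<Rightarrow> real"
  assumes k: "crm_index M N k" and \<pi>: "bij_betw \<pi> {1..k} {1..k}"
    and ij: "i \<in> {1..k}" "j \<in> {1..k}" and h [measurable]: "h \<in> borel_measurable (borel \<Otimes>\<^sub>M borel)"
  shows "cexp M N (\<lambda>\<omega>. h (X (\<pi> i) \<omega>, X (\<pi> j) \<omega>)) n = cexp M N (\<lambda>\<omega>. h (X i \<omega>, X j \<omega>)) n"
proof -
  let ?f = "\<lambda>v::nat \<Rightarrow> real. indicator {real n} (v 0) * h (v i, v j)"
  have f: "?f \<in> borel_measurable (PiM {0..k} (\<lambda>_. borel))"
  proof -
    have [measurable]: "(\<lambda>v. v l) \<in> borel_measurable (PiM {0..k} (\<lambda>_. borel :: real measure))" if "l \<in> {0..k}" for l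
      using that by (rule measurable_component_singleton)
    show ?thesis using ij by simp
  qed
  have v: "crm_vec N X k g \<in> measurable M (PiM {0..k} (\<lambda>_. borel))" if "\<And>l. l \<in> {1..k} \<Longrightarrow> g l \<in> {1..k}" for g
    unfolding crm_vec_def
  proof (rule measurable_restrict)
    fix l assume "l \<in> {0..k}"
    then show "(\<lambda>\<omega>. if l = 0 then real (N \<omega>) else X (g l) \<omega>) \<in> borel_measurable M"
      using that[of l] X_measurable[of "g l"] by (cases "l = 0") auto
  qed
  have i: "(\<integral>\<omega>. indicator {\<omega>\<in>space M. N \<omega> = n} \<omega> * h (X (g i) \<omega>, X (g j) \<omega>) \<partial>M)
    = (\<integral>v. ?f v \<partial>distr M (PiM {0..k} (\<lambda>_. borel)) (crm_vec N X k g))"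
    if "\<And>l. l \<in> {1..k} \<Longrightarrow> g l \<in> {1..k}" for g
  proof -
    have "(\<integral>v. ?f v \<partial>distr M (PiM {0..k} (\<lambda>_. borel)) (crm_vec N X k g)) = (\<integral>\<omega>. ?f (crm_vec N X k g \<omega>) \<partial>M)"
      by (intro integral_distr v f that)
    also have "\<dots> = (\<integral>\<omega>. indicator {\<omega>\<in>space M. N \<omega> = n} \<omega> * h (X (g i) \<omega>, X (g j) \<omega>) \<partial>M)"
      by (intro Bochner_Integration.integral_cong) (use ij in \<open>auto simp: crm_vec_def split: split_indicator\<close>)
    finally show ?thesis ..
  qed
  have \<pi>': "\<And>l. l \<in> {1..k} \<Longrightarrow> \<pi> l \<in> {1..k}" using \<pi> by (auto simp: bij_betw_def)
  have "distr M (PiM {0..k} (\<lambda>_. borel)) (crm_vec N X k id) = distr M (PiM {0..k} (\<lambda>_. borel)) (crm_vec N X k \<pi>)"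
    using fgm k \<pi> unfolding in_FGM_star_def by blast
  then show ?thesis
    using i[of \<pi>, OF \<pi>'] i[of id] by (simp add: cexp_def)
qed

lemma cexp_exchange1:
  fixes h :: "real \<Rightarrow> real"
  assumes "crm_index M N k" "i \<in> {1..k}" and h [measurable]: "h \<in> borel_measurable borel"
  shows "cexp M N (\<lambda>\<omega>. h (X i \<omega>)) n = cexp M N (\<lambda>\<omega>. h (X 1 \<omega>)) n"
proof -
  have "bij_betw (Transposition.transpose 1 i) {1..k} {1..k}"
    using assms by (intro permutes_imp_bij permutes_swap_id) auto
  from cexp_exchange[OF assms(1) this, of 1 1 "\<lambda>p. h (fst p)" n] assms(2) show ?thesis
    by auto
qed

lemma cexp_exchange2:
  fixes h :: "real \<times> real \<Rightarrow> real"
  assumes "crm_index M N k" "i \<in> {1..k}" "j \<in> {1..k}" "i \<noteq> j"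
    and "h \<in> borel_measurable (borel \<Otimes>\<^sub>M borel)"
  shows "cexp M N (\<lambda>\<omega>. h (X i \<omega>, X j \<omega>)) n = cexp M N (\<lambda>\<omega>. h (X 1 \<omega>, X 2 \<omega>)) n"
proof -
  have k2: "2 \<le> k" using assms(2-4) by auto
  \<comment> \<open>The permutation swaps 2 with \<open>j'\<close> and then 1 with \<open>i\<close>.
    It fixes 1 in the inner swap since \<open>j'\<close> differs from 1, so it sends 1 to
    \<open>i\<close>; it sends 2 to \<open>j\<close> since a transposition is its own inverse.
    Overlaps such as i = 2 or j = 1 need no separate case.\<close>
  define j' where "j' = Transposition.transpose 1 i j"
  have j': "j' \<in> {1..k}" "j' \<noteq> 1" using assms k2 by (auto simp: j'_def Transposition.transpose_def)
  have "bij_betw (Transposition.transpose 1 i) {1..k} {1..k}" "bij_betw (Transposition.transpose 2 j') {1..k} {1..k}"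
    using assms k2 j' by (auto intro!: permutes_imp_bij permutes_swap_id)
  then have "bij_betw (Transposition.transpose 1 i \<circ> Transposition.transpose 2 j') {1..k} {1..k}"
    by (rule bij_betw_trans[rotated])
  from cexp_exchange[OF assms(1) this _ _ assms(5), of 1 2 n] j' k2 show ?thesis
    by (simp add: j'_def)
qed

section \<open>Joint cdfs of the claims on the event N = n\<close>

text \<open>N is integer valued, so the increment from n - 1 to n isolates n. The subtraction is in
  the reals: for n = 0 the lower threshold is -1 and its event is empty.\<close>

lemma joint_cdf_diff:
  assumes Q: "Measurable.pred M Q"
  shows "prob {\<omega>\<in>space M. N \<omega> = n \<and> Q \<omega>}
    = prob {\<omega>\<in>space M. real (N \<omega>) \<le> real n \<and> Q \<omega>} - prob {\<omega>\<in>space M. real (N \<omega>) \<le> real n - 1 \<and> Q \<omega>}"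
proof -
  have e: "{\<omega>\<in>space M. N \<omega> = n \<and> Q \<omega>} = {\<omega>\<in>space M. real (N \<omega>) \<le> real n \<and> Q \<omega>} - {\<omega>\<in>space M. real (N \<omega>) \<le> real n - 1 \<and> Q \<omega>}"
    by auto
  show ?thesis
    unfolding e using Q by (intro finite_measure_Diff) (measurable, auto)
qed

text \<open>The increment of \<open>u (1 - u)\<close> along the cdf of N at n, which is how N enters every copula
  term involving coordinate 0.\<close>

definition kappa :: "nat \<Rightarrow> real" where
  "kappa n = (gammaN1 M N n - gammaN2 M N n) / 2"

lemma gammaN_kappa:
  defines "F \<equiv> \<lambda>t. prob {\<omega>\<in>space M. real (N \<omega>) \<le> t}"
  shows "gammaN M N n = F (real n) - F (real n - 1)"
    "kappa n = F (real n) * (1 - F (real n)) - F (real n - 1) * (1 - F (real n - 1))"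
proof -
  have "{\<omega>\<in>space M. real (N \<omega>) \<le> real n - 1} = {\<omega>\<in>space M. N \<omega> < n}" by auto
  then have F: "F (real n) = prob {\<omega>\<in>space M. N \<omega> \<le> n}" "F (real n - 1) = prob {\<omega>\<in>space M. N \<omega> < n}"
    by (simp_all add: F_def)
  show "gammaN M N n = F (real n) - F (real n - 1)"
    unfolding F by (rule gammaN_eq_diff) simp
  show "kappa n = F (real n) * (1 - F (real n)) - F (real n - 1) * (1 - F (real n - 1))"
    unfolding F kappa_def gammaN2_eq[OF N_measurable] gammaN1_eq[OF N_measurable]
    by (simp add: power2_eq_square field_simps)
qed

lemma joint_cdf_copula:
  assumes "crm_index M N k"
  shows "prob {\<omega>\<in>space M. real (N \<omega>) \<le> t \<and> (\<forall>j\<in>{1..k}. X j \<omega> \<le> x j)} =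
    fgm_copula {0..k} (\<theta> k)
      (\<lambda>i. if i = 0 then prob {\<omega> \<in> space M. real (N \<omega>) \<le> t} else prob {\<omega> \<in> space M. X 1 \<omega> \<le> x i})"
  using fgm assms by (simp only: in_FGM_star_def in_FGM_def)

lemma joint_cdf1:
  assumes k: "crm_index M N 1"
  shows "prob {\<omega>\<in>space M. N \<omega> = n \<and> X 1 \<omega> \<le> x}
    = gammaN M N n * prob {\<omega>\<in>space M. X 1 \<omega> \<le> x}
      + \<theta>01 * kappa n * (prob {\<omega>\<in>space M. X 1 \<omega> \<le> x} * (1 - prob {\<omega>\<in>space M. X 1 \<omega> \<le> x}))"
proof -
  have C: "prob {\<omega>\<in>space M. real (N \<omega>) \<le> t \<and> X 1 \<omega> \<le> x}
    = prob {\<omega>\<in>space M. real (N \<omega>) \<le> t} * prob {\<omega>\<in>space M. X 1 \<omega> \<le> x}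
      * (1 + \<theta>01 * ((1 - prob {\<omega>\<in>space M. real (N \<omega>) \<le> t}) * (1 - prob {\<omega>\<in>space M. X 1 \<omega> \<le> x})))" for t
  proof -
    have "prob {\<omega>\<in>space M. real (N \<omega>) \<le> t \<and> (\<forall>j\<in>{1..1}. X j \<omega> \<le> x)} =
           fgm_copula {0..1} (\<theta> 1)
             (\<lambda>i. if i = 0 then prob {\<omega> \<in> space M. real (N \<omega>) \<le> t} else prob {\<omega> \<in> space M. X 1 \<omega> \<le> x})"
      by (rule joint_cdf_copula[OF k])
    then show ?thesis
      unfolding fgm_copula_01 using par01[OF k, of 1] by simp
  qed
  have "Measurable.pred M (\<lambda>\<omega>. X 1 \<omega> \<le> x)" by measurable
  from joint_cdf_diff[OF this, of n] show ?thesis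
    unfolding C gammaN_kappa by algebra
qed

text \<open>As a function of u, the cdf of N, the copula is a combination of \<open>u\<close> and
  \<open>u (1 - u)\<close>, whose increments are \<open>gammaN\<close> and \<open>kappa\<close>. The
  theta12 term does not involve coordinate 0 and so carries \<open>gammaN\<close>; the theta01 and
  theta012 terms carry \<open>kappa\<close>.\<close>

lemma joint_cdf2:
  assumes k: "crm_index M N 2"
  defines "F \<equiv> \<lambda>s. prob {\<omega>\<in>space M. X 1 \<omega> \<le> s}"
  shows "prob {\<omega>\<in>space M. N \<omega> = n \<and> X 1 \<omega> \<le> x \<and> X 2 \<omega> \<le> y}
    = F x * F y * (gammaN M N n + \<theta>01 * kappa n * ((1 - F x) + (1 - F y))
        + (\<theta>12 * gammaN M N n + \<theta>012 * kappa n) * ((1 - F x) * (1 - F y)))"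
proof -
  have C: "prob {\<omega>\<in>space M. real (N \<omega>) \<le> t \<and> X 1 \<omega> \<le> x \<and> X 2 \<omega> \<le> y}
    = (let u = prob {\<omega>\<in>space M. real (N \<omega>) \<le> t} in
      u * F x * F y * (1 + \<theta>01 * ((1 - u) * (1 - F x)) + \<theta>01 * ((1 - u) * (1 - F y)) + \<theta>12 * ((1 - F x) * (1 - F y))
        + \<theta>012 * ((1 - u) * (1 - F x) * (1 - F y))))" for t
  proof -
    let ?x = "\<lambda>j. if j = 1 then x else y"
    have "prob {\<omega>\<in>space M. real (N \<omega>) \<le> t \<and> (\<forall>j\<in>{1..2}. X j \<omega> \<le> ?x j)} =
           fgm_copula {0..2} (\<theta> 2)
             (\<lambda>i. if i = 0 then prob {\<omega> \<in> space M. real (N \<omega>) \<le> t} else prob {\<omega> \<in> space M. X 1 \<omega> \<le> ?x i})"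
      by (rule joint_cdf_copula[OF k])
    moreover have "(\<forall>j\<in>{1..2}. X j \<omega> \<le> ?x j) \<longleftrightarrow> X 1 \<omega> \<le> x \<and> X 2 \<omega> \<le> y" for \<omega>
      by (auto simp: numeral_2_eq_2 atLeastAtMostSuc_conv)
    ultimately show ?thesis
      unfolding fgm_copula_012 using par01[OF k, of 1] par01[OF k, of 2] par12[OF k, of 1 2] par012[OF k, of 1 2]
      by (simp add: F_def Let_def)
  qed
  have "Measurable.pred M (\<lambda>\<omega>. X 1 \<omega> \<le> x \<and> X 2 \<omega> \<le> y)" by measurable
  from joint_cdf_diff[OF this, of n] show ?thesis
    unfolding C Let_def gammaN_kappa by algebra
qed

lemma kappa_eq: "kappa n = - (gammaN M N n * Rratio M N n) / 2"
  unfolding kappa_def gammaN_times_Rratio[OF N_measurable] by simp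

lemma prob_event_N: "prob {\<omega>\<in>space M. N \<omega> = n} = gammaN M N n"
  by (simp add: gammaN_def)

lemma event_N_conj: "{\<omega> \<in> {\<omega>\<in>space M. N \<omega> = n}. Q \<omega>} = {\<omega>\<in>space M. N \<omega> = n \<and> Q \<omega>}"
  by auto

section \<open>Conditional moments given N = n\<close>

text \<open>A support value \<open>n\<close> with \<open>1 \<le> n\<close> makes 1 an admissible
  copula index. The factor 1/4 is the half in \<open>kappa_eq\<close> times the half in D/2, and the
  two minus signs cancel.\<close>

lemma cexp_X1:
  assumes g: "gammaN M N n > 0" and n: "1 \<le> n"
  shows "cexp M N (X 1) n = expectation (X 1) + \<theta>01 / 4 * Rratio M N n * Ddiff M X"
proof -
  have k: "crm_index M N 1" using crm_index_if[OF g _ n] by simp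
  have "(\<integral>\<omega>. indicator {\<omega>\<in>space M. N \<omega> = n} \<omega> * X 1 \<omega> \<partial>M)
    = gammaN M N n * expectation (X 1) - \<theta>01 * kappa n * (Ddiff M X / 2)"
    unfolding Ddiff_def lawX_def
    by (rule expectation_indicator_fgm[OF _ intX1 X_nonneg])
       (simp_all only: event_N_conj joint_cdf1[OF k] prob_event_N, simp_all)
  then have "gammaN M N n * cexp M N (X 1) n
    = gammaN M N n * (expectation (X 1) + \<theta>01 / 4 * Rratio M N n * Ddiff M X)"
    unfolding integral_indicator_eq_cexp kappa_eq by (simp add: field_simps)
  with g show ?thesis by simp
qed

lemma cexp_X1_sq:
  assumes g: "gammaN M N n > 0" and n: "1 \<le> n"
  shows "cexp M N (\<lambda>\<omega>. X 1 \<omega> ^ 2) n = expectation (\<lambda>\<omega>. X 1 \<omega> ^ 2)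
    + \<theta>01 / 4 * Rratio M N n * (mom2 (law_max2 (lawX M X)) - mom2 (law_min2 (lawX M X)))"
proof -
  have k: "crm_index M N 1" using crm_index_if[OF g _ n] by simp
  \<comment> \<open>The square of the claim thus has the same FGM form with its own margin.
    \<open>Q\<close> stands for the event N = n or for the whole space. For negative
    \<open>s\<close> both sets are null, as \<open>sqrt s\<close> is then negative.\<close>
  have sq: "prob {\<omega>\<in>space M. Q \<omega> \<and> X 1 \<omega> ^ 2 \<le> s} = prob {\<omega>\<in>space M. Q \<omega> \<and> X 1 \<omega> \<le> sqrt s}"
    if [measurable]: "Measurable.pred M Q" for Q s
  proof (rule finite_measure_eq_AE)
    show "AE \<omega> in M. (\<omega> \<in> {\<omega>\<in>space M. Q \<omega> \<and> X 1 \<omega> ^ 2 \<le> s}) = (\<omega> \<in> {\<omega>\<in>space M. Q \<omega> \<and> X 1 \<omega> \<le> sqrt s})"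
      using X_nonneg[of 1, simplified]
    proof eventually_elim
      case (elim \<omega>)
      then have "X 1 \<omega> ^ 2 \<le> s \<longleftrightarrow> X 1 \<omega> \<le> sqrt s"
        by (metis One_nat_def real_le_rsqrt real_sqrt_le_iff real_sqrt_unique)
      then show ?case by auto
    qed
  qed measurable
  have sq': "prob {\<omega>\<in>space M. X 1 \<omega> ^ 2 \<le> s} = prob {\<omega>\<in>space M. X 1 \<omega> \<le> sqrt s}" for s
    using sq[of "\<lambda>_. True"] by simp
  have pN: "Measurable.pred M (\<lambda>\<omega>. N \<omega> = n)" by measurable
  have pos: "AE \<omega> in M. 0 \<le> X 1 \<omega>" using X_nonneg[of 1] by simp
  have "(\<integral>\<omega>. indicator {\<omega>\<in>space M. N \<omega> = n} \<omega> * (X 1 \<omega>) ^ 2 \<partial>M)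
    = gammaN M N n * expectation (\<lambda>\<omega>. X 1 \<omega> ^ 2)
      - \<theta>01 * kappa n * ((mom2 (law_max2 (lawX M X)) - mom2 (law_min2 (lawX M X))) / 2)"
    unfolding lawX_def mom2_max2_distr[OF X12_measurable(1) pos] mom2_min2_distr[OF X12_measurable(1) pos]
    by (rule expectation_indicator_fgm[OF _ intX2])
       (simp_all only: event_N_conj sq[OF pN] sq' joint_cdf1[OF k] prob_event_N, simp_all)
  then have "gammaN M N n * cexp M N (\<lambda>\<omega>. X 1 \<omega> ^ 2) n = gammaN M N n * (expectation (\<lambda>\<omega>. X 1 \<omega> ^ 2)
    + \<theta>01 / 4 * Rratio M N n * (mom2 (law_max2 (lawX M X)) - mom2 (law_min2 (lawX M X))))"
    unfolding integral_indicator_eq_cexp kappa_eq by (simp add: field_simps)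
  with g show ?thesis by simp
qed

lemma cexp_X2:
  assumes g: "gammaN M N n > 0" and n: "2 \<le> n"
  shows "cexp M N (X 2) n = cexp M N (X 1) n"
  using cexp_exchange1[OF crm_index_if[OF g _ n], of 2 "\<lambda>x. x" n] by simp

text \<open>The pair formula with c = theta01 * \<open>kappa\<close> and e = theta12 *
  \<open>gammaN\<close> + theta012 * \<open>kappa\<close>. Both claims have the same law, so the two
  mixed terms coincide and double 1/4 to 1/2.\<close>

lemma cexp_X1X2:
  assumes g: "gammaN M N n > 0" and n: "2 \<le> n"
  shows "cexp M N (\<lambda>\<omega>. X 1 \<omega> * X 2 \<omega>) n = (expectation (X 1)) ^ 2
    + \<theta>01 / 2 * Rratio M N n * expectation (X 1) * Ddiff M X
    + (\<theta>12 / 4 - \<theta>012 / 8 * Rratio M N n) * Ddiff M X ^ 2"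
proof -
  have k: "crm_index M N 1" "crm_index M N 2" using crm_index_if[OF g] n by simp_all
  have lawX2: "distr M borel (X 2) = distr M borel (X 1)" by (rule X_distr) simp
  have E2: "expectation (X 2) = expectation (X 1)"
    using integral_distr[OF X12_measurable(2) measurable_ident] integral_distr[OF X12_measurable(1) measurable_ident]
    unfolding lawX2 id_apply by (rule trans[OF sym])
  have F2: "prob {\<omega>\<in>space M. X 2 \<omega> \<le> t} = prob {\<omega>\<in>space M. X 1 \<omega> \<le> t}" for t
  proof -
    have "prob {\<omega>\<in>space M. Z \<omega> \<le> t} = measure (distr M borel Z) {..t}" if "Z \<in> borel_measurable M" for Z :: "'a \<Rightarrow> real"
      using that by (subst measure_distr) (auto intro!: arg_cong[where f = prob])
    from this[OF X12_measurable(2)] this[OF X12_measurable(1), symmetric] show ?thesis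
      unfolding lawX2 by (rule trans)
  qed
  \<comment> \<open>This concerns the joint law with N, so it comes from exchangeability applied to
    a threshold indicator, whereas \<open>E2\<close> and \<open>F2\<close> follow from the common
    law of the claims.\<close>
  have c2: "prob {\<omega>\<in>space M. N \<omega> = n \<and> X 2 \<omega> \<le> t} = prob {\<omega>\<in>space M. N \<omega> = n \<and> X 1 \<omega> \<le> t}" for t
  proof -
    have "prob {\<omega>\<in>space M. N \<omega> = n \<and> Z \<omega> \<le> t} = gammaN M N n * cexp M N (\<lambda>\<omega>. indicator {..t} (Z \<omega>)) n"
      if [measurable]: "Z \<in> borel_measurable M" for Z :: "'a \<Rightarrow> real"
    proof -
      have "(\<integral>\<omega>. indicator {\<omega>\<in>space M. N \<omega> = n} \<omega> * indicator {..t} (Z \<omega>) \<partial>M)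
        = (\<integral>\<omega>. indicat_real {\<omega>\<in>space M. N \<omega> = n \<and> Z \<omega> \<le> t} \<omega> \<partial>M)"
        by (intro Bochner_Integration.integral_cong) (auto split: split_indicator)
      then show ?thesis by (simp add: integral_indicator_eq_cexp)
    qed
    note c = this
    have "cexp M N (\<lambda>\<omega>. indicator {..t} (X 2 \<omega>)) n = cexp M N (\<lambda>\<omega>. indicator {..t} (X 1 \<omega>)) n"
      by (rule cexp_exchange1[OF k(2)]) simp_all
    then show ?thesis unfolding c[OF X12_measurable(1)] c[OF X12_measurable(2)] by (rule arg_cong)
  qed
  have "(\<integral>\<omega>. indicator {\<omega>\<in>space M. N \<omega> = n} \<omega> * (X 1 \<omega> * X 2 \<omega>) \<partial>M)
    = gammaN M N n * expectation (X 1) * expectation (X 2)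
      - \<theta>01 * kappa n * ((mom1 (law_max2 (distr M borel (X 1))) - mom1 (law_min2 (distr M borel (X 1)))) / 2 * expectation (X 2)
          + expectation (X 1) * ((mom1 (law_max2 (distr M borel (X 2))) - mom1 (law_min2 (distr M borel (X 2)))) / 2))
      + (\<theta>12 * gammaN M N n + \<theta>012 * kappa n)
          * ((mom1 (law_max2 (distr M borel (X 1))) - mom1 (law_min2 (distr M borel (X 1)))) / 2)
          * ((mom1 (law_max2 (distr M borel (X 2))) - mom1 (law_min2 (distr M borel (X 2)))) / 2)"
  proof (rule expectation_indicator_prod_fgm)
    show "integrable M (X 1)" "integrable M (X 2)" "integrable M (\<lambda>\<omega>. X 1 \<omega> * X 2 \<omega>)"
      "AE \<omega> in M. 0 \<le> X 1 \<omega>" "AE \<omega> in M. 0 \<le> X 2 \<omega>"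
      by (intro integrable_X integrable_X_times_X X_nonneg; simp)+
  qed (simp_all only: event_N_conj joint_cdf1[OF k(1)] joint_cdf2[OF k(2)] prob_event_N F2 c2, measurable)
  then have "gammaN M N n * cexp M N (\<lambda>\<omega>. X 1 \<omega> * X 2 \<omega>) n
    = gammaN M N n * ((expectation (X 1)) ^ 2
    + \<theta>01 / 2 * Rratio M N n * expectation (X 1) * Ddiff M X
    + (\<theta>12 / 4 - \<theta>012 / 8 * Rratio M N n) * Ddiff M X ^ 2)"
    unfolding integral_indicator_eq_cexp kappa_eq E2 lawX2 lawX_def[symmetric] Ddiff_def[symmetric]
    by (simp add: field_simps power2_eq_square)
  with g show ?thesis by simp
qed

section \<open>Moments of the aggregate claim\<close>

lemma aggS_measurable [measurable]: "aggS N X \<in> borel_measurable M"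
proof -
  have "(\<lambda>\<omega>. (\<lambda>n \<omega>. \<Sum>j\<in>{1..n}. X j \<omega>) (N \<omega>) \<omega>) \<in> borel_measurable M"
    by (rule measurable_compose_countable[OF _ N_measurable])
       (auto intro!: borel_measurable_sum X_measurable)
  then show ?thesis by (simp add: aggS_def[abs_def])
qed

lemma aggS_nonneg: "AE \<omega> in M. 0 \<le> aggS N X \<omega>"
proof -
  have "AE \<omega> in M. \<forall>j. 1 \<le> j \<longrightarrow> 0 \<le> X j \<omega>"
    unfolding AE_all_countable using X_nonneg by (auto intro: AE_impI)
  then show ?thesis
    by eventually_elim (auto simp: aggS_def intro!: sum_nonneg)
qed

lemma indicator_aggS:
  "integrable M (\<lambda>\<omega>. indicator {\<omega>\<in>space M. N \<omega> = n} \<omega> * aggS N X \<omega>)"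
  "(\<integral>\<omega>. indicator {\<omega>\<in>space M. N \<omega> = n} \<omega> * aggS N X \<omega> \<partial>M)
    = gammaN M N n * (real n * cexp M N (X 1) n)"
proof -
  have e: "(\<lambda>\<omega>. indicator {\<omega>\<in>space M. N \<omega> = n} \<omega> * aggS N X \<omega>)
    = (\<lambda>\<omega>. \<Sum>j\<in>{1..n}. indicator {\<omega>\<in>space M. N \<omega> = n} \<omega> * X j \<omega>)"
  proof
    fix \<omega>
    show "indicator {\<omega>\<in>space M. N \<omega> = n} \<omega> * aggS N X \<omega>
      = (\<Sum>j\<in>{1..n}. indicator {\<omega>\<in>space M. N \<omega> = n} \<omega> * X j \<omega>)"
      by (cases "\<omega> \<in> space M \<and> N \<omega> = n") (auto simp: aggS_def indicator_def)
  qed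
  have int: "integrable M (\<lambda>\<omega>. indicator {\<omega>\<in>space M. N \<omega> = n} \<omega> * X j \<omega>)" if "j \<in> {1..n}" for j
    using that by (intro integrable_indicator_times integrable_X) simp
  show "integrable M (\<lambda>\<omega>. indicator {\<omega>\<in>space M. N \<omega> = n} \<omega> * aggS N X \<omega>)"
    unfolding e by (intro Bochner_Integration.integrable_sum int)
  \<comment> \<open>Keeping the factor \<open>gammaN\<close> makes the equation trivial off the
    support; on it, exchangeability is used with k = n.\<close>
  have c: "gammaN M N n * cexp M N (X j) n = gammaN M N n * cexp M N (X 1) n" if "j \<in> {1..n}" for j
  proof (cases "gammaN M N n = 0")
    case False
    then have "gammaN M N n > 0" using gammaN_nonneg[of N n] by linarith
    from cexp_exchange1[OF crm_index_if[OF this, of n] that, of "\<lambda>x. x" n] that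
    show ?thesis by simp
  qed simp
  have "(\<integral>\<omega>. indicator {\<omega>\<in>space M. N \<omega> = n} \<omega> * aggS N X \<omega> \<partial>M)
    = (\<Sum>j\<in>{1..n}. gammaN M N n * cexp M N (X j) n)"
    unfolding e by (subst Bochner_Integration.integral_sum[OF int]) (auto simp: integral_indicator_eq_cexp)
  also have "\<dots> = (\<Sum>j\<in>{1..n}. gammaN M N n * cexp M N (X 1) n)"
    by (intro sum.cong refl c)
  finally show "(\<integral>\<omega>. indicator {\<omega>\<in>space M. N \<omega> = n} \<omega> * aggS N X \<omega> \<partial>M)
    = gammaN M N n * (real n * cexp M N (X 1) n)" by simp
qed

lemma indicator_aggS_sq:
  "integrable M (\<lambda>\<omega>. indicator {\<omega>\<in>space M. N \<omega> = n} \<omega> * aggS N X \<omega> ^ 2)"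
  "(\<integral>\<omega>. indicator {\<omega>\<in>space M. N \<omega> = n} \<omega> * aggS N X \<omega> ^ 2 \<partial>M)
    = gammaN M N n * (real n * cexp M N (\<lambda>\<omega>. X 1 \<omega> ^ 2) n
        + real n * (real n - 1) * cexp M N (\<lambda>\<omega>. X 1 \<omega> * X 2 \<omega>) n)"
proof -
  let ?a = "gammaN M N n * cexp M N (\<lambda>\<omega>. X 1 \<omega> ^ 2) n"
  let ?b = "gammaN M N n * cexp M N (\<lambda>\<omega>. X 1 \<omega> * X 2 \<omega>) n"
  have e: "(\<lambda>\<omega>. indicator {\<omega>\<in>space M. N \<omega> = n} \<omega> * aggS N X \<omega> ^ 2)
    = (\<lambda>\<omega>. \<Sum>i\<in>{1..n}. \<Sum>j\<in>{1..n}. indicator {\<omega>\<in>space M. N \<omega> = n} \<omega> * (X i \<omega> * X j \<omega>))"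
  proof
    fix \<omega>
    show "indicator {\<omega>\<in>space M. N \<omega> = n} \<omega> * aggS N X \<omega> ^ 2
      = (\<Sum>i\<in>{1..n}. \<Sum>j\<in>{1..n}. indicator {\<omega>\<in>space M. N \<omega> = n} \<omega> * (X i \<omega> * X j \<omega>))"
      by (cases "\<omega> \<in> space M \<and> N \<omega> = n") (auto simp: aggS_def indicator_def power2_eq_square sum_product)
  qed
  have int: "integrable M (\<lambda>\<omega>. indicator {\<omega>\<in>space M. N \<omega> = n} \<omega> * (X i \<omega> * X j \<omega>))"
    if "i \<in> {1..n}" "j \<in> {1..n}" for i j
    using that by (intro integrable_indicator_times integrable_X_times_X) simp_all
  show "integrable M (\<lambda>\<omega>. indicator {\<omega>\<in>space M. N \<omega> = n} \<omega> * aggS N X \<omega> ^ 2)"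
    unfolding e by (intro Bochner_Integration.integrable_sum int)
  \<comment> \<open>Constant plus diagonal correction: the double sum then gives n(a - b) + n^2 b,
    which is na + n(n - 1)b.\<close>
  have c: "gammaN M N n * cexp M N (\<lambda>\<omega>. X i \<omega> * X j \<omega>) n = (if i = j then ?a - ?b else 0) + ?b"
    if ij: "i \<in> {1..n}" "j \<in> {1..n}" for i j
  proof (cases "gammaN M N n = 0")
    case False
    then have "gammaN M N n > 0" using gammaN_nonneg[of N n] by linarith
    then have k: "crm_index M N n" using crm_index_if[of n n] ij by simp
    show ?thesis
    proof (cases "i = j")
      case True
      then show ?thesis
        using cexp_exchange1[OF k ij(1), of "\<lambda>x. x ^ 2" n] by (simp add: power2_eq_square)
    next
      case False
      then show ?thesis
        using cexp_exchange2[OF k ij False, of "\<lambda>p. fst p * snd p" n] by simp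
    qed
  qed simp
  have "(\<integral>\<omega>. indicator {\<omega>\<in>space M. N \<omega> = n} \<omega> * aggS N X \<omega> ^ 2 \<partial>M)
    = (\<Sum>i\<in>{1..n}. \<Sum>j\<in>{1..n}. gammaN M N n * cexp M N (\<lambda>\<omega>. X i \<omega> * X j \<omega>) n)"
    unfolding e
    by (subst Bochner_Integration.integral_sum, intro Bochner_Integration.integrable_sum int, assumption+,
        intro sum.cong refl, subst Bochner_Integration.integral_sum[OF int])
       (auto simp: integral_indicator_eq_cexp)
  also have "\<dots> = (\<Sum>i\<in>{1..n}. \<Sum>j\<in>{1..n}. (if i = j then ?a - ?b else 0) + ?b)"
    by (intro sum.cong refl c)
  also have "\<dots> = (\<Sum>i\<in>{1..n}. (?a - ?b) + real n * ?b)"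
    by (intro sum.cong refl) (simp add: sum.distrib)
  also have "\<dots> = gammaN M N n * (real n * cexp M N (\<lambda>\<omega>. X 1 \<omega> ^ 2) n
        + real n * (real n - 1) * cexp M N (\<lambda>\<omega>. X 1 \<omega> * X 2 \<omega>) n)"
    by (simp add: algebra_simps)
  finally show "(\<integral>\<omega>. indicator {\<omega>\<in>space M. N \<omega> = n} \<omega> * aggS N X \<omega> ^ 2 \<partial>M)
    = gammaN M N n * (real n * cexp M N (\<lambda>\<omega>. X 1 \<omega> ^ 2) n
        + real n * (real n - 1) * cexp M N (\<lambda>\<omega>. X 1 \<omega> * X 2 \<omega>) n)" .
qed

section \<open>Mixed moments of N and R\<close>

text \<open>Only p = 1, 2 and q = 0, 1, 2 occur. q = 0 gives moments of N, q = 1 differences of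
  moments of maximum and minimum, and q = 2 the series in R^2 that remain in the three partial
  formulas.\<close>

abbreviation R_moment :: "nat \<Rightarrow> nat \<Rightarrow> real" where
  "R_moment p q \<equiv> expectation (\<lambda>\<omega>. real (N \<omega>) ^ p * Rratio M N (N \<omega>) ^ q)"

lemma R_moment_integrable:
  assumes "p = 1 \<or> p = 2"
  shows "integrable M (\<lambda>\<omega>. real (N \<omega>) ^ p * Rratio M N (N \<omega>) ^ q)"
  using assms intN1 intN2 by (intro integrable_power_times_Rratio) auto

lemma R_moment_has_bochner_integral:
  assumes "p = 1 \<or> p = 2"
  shows "has_bochner_integral M (\<lambda>\<omega>. real (N \<omega>) ^ p * Rratio M N (N \<omega>) ^ q) (R_moment p q)"
  by (rule has_bochner_integral_integrable[OF R_moment_integrable[OF assms]])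

lemma R_moment_0: "R_moment 1 0 = mom1 (lawN M N)" "R_moment 2 0 = mom2 (lawN M N)"
  by (simp_all add: mom1_def mom2_def lawN_def integral_distr)

lemma R_moment_1:
  "R_moment 1 1 = mom1 (law_max2 (lawN M N)) - mom1 (law_min2 (lawN M N))"
  "R_moment 2 1 = mom2 (law_max2 (lawN M N)) - mom2 (law_min2 (lawN M N))"
  using expectation_power_times_Rratio[OF N_measurable, of 1] expectation_power_times_Rratio[OF N_measurable, of 2]
    intN1 intN2
  by (simp_all add: mom1_def mom2_def)

lemma R_moment_2:
  "R_moment 1 2 = (\<Sum>n. gammaN M N n * real n * Rratio M N n ^ 2)"
  "R_moment 2 2 = (\<Sum>n. gammaN M N n * real n ^ 2 * Rratio M N n ^ 2)"
  using expectation_gammaN_sums[OF N_measurable R_moment_integrable[of 1 2]]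
    expectation_gammaN_sums[OF N_measurable R_moment_integrable[of 2 2]]
  by (simp_all add: sums_iff mult.assoc)

section \<open>The three parts of the variance\<close>

lemma has_bochner_integral_N_cvar:
  defines "m \<equiv> expectation (X 1)"
  shows "has_bochner_integral M (\<lambda>\<omega>. real (N \<omega>) * cvar M N (X 1) (N \<omega>))
    ((expectation (\<lambda>\<omega>. X 1 \<omega> ^ 2) - m ^ 2) * R_moment 1 0
      + \<theta>01 / 4 * (mom2 (law_max2 (lawX M X)) - mom2 (law_min2 (lawX M X)) - 2 * m * Ddiff M X) * R_moment 1 1
      - \<theta>01 ^ 2 / 16 * Ddiff M X ^ 2 * R_moment 1 2)" (is "has_bochner_integral M _ ?v")
proof -
  let ?q = "mom2 (law_max2 (lawX M X)) - mom2 (law_min2 (lawX M X))"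
  have i: "has_bochner_integral M (\<lambda>\<omega>. (expectation (\<lambda>\<omega>. X 1 \<omega> ^ 2) - m ^ 2) * (real (N \<omega>) ^ 1 * Rratio M N (N \<omega>) ^ 0)
      + \<theta>01 / 4 * (?q - 2 * m * Ddiff M X) * (real (N \<omega>) ^ 1 * Rratio M N (N \<omega>) ^ 1)
      - \<theta>01 ^ 2 / 16 * Ddiff M X ^ 2 * (real (N \<omega>) ^ 1 * Rratio M N (N \<omega>) ^ 2)) ?v"
    by (intro has_bochner_integral_diff has_bochner_integral_add has_bochner_integral_mult_right
      R_moment_has_bochner_integral) simp_all
  show ?thesis
  proof (rule has_bochner_integral_cong_AE[THEN iffD1, OF _ _ _ i])
    show "AE \<omega> in M. (expectation (\<lambda>\<omega>. X 1 \<omega> ^ 2) - m ^ 2) * (real (N \<omega>) ^ 1 * Rratio M N (N \<omega>) ^ 0)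
      + \<theta>01 / 4 * (?q - 2 * m * Ddiff M X) * (real (N \<omega>) ^ 1 * Rratio M N (N \<omega>) ^ 1)
      - \<theta>01 ^ 2 / 16 * Ddiff M X ^ 2 * (real (N \<omega>) ^ 1 * Rratio M N (N \<omega>) ^ 2)
      = real (N \<omega>) * cvar M N (X 1) (N \<omega>)"
      using AE_gammaN_pos
    proof eventually_elim
      case (elim \<omega>)
      show ?case
      proof (cases "N \<omega> = 0")
        case False
        then have "1 \<le> N \<omega>" by simp
        then show ?thesis
          unfolding cvar_def cexp_X1[OF elim \<open>1 \<le> N \<omega>\<close>] cexp_X1_sq[OF elim \<open>1 \<le> N \<omega>\<close>] m_def
          by (simp add: field_simps power2_eq_square)
      qed simp
    qed
  qed measurable
qed

text \<open>In the conditional covariance the mean and the term linear in theta01 cancel, leaving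
  D^2 (theta12/4 - (theta012/8) R - (theta01^2/16) R^2). At N = 0 and N = 1 the factor n(n - 1) is
  0, whatever \<open>ccov\<close> is there; this is the convention for sup A_N \<le> 1.\<close>

lemma has_bochner_integral_N_ccov:
  "has_bochner_integral M (\<lambda>\<omega>. real (N \<omega>) * (real (N \<omega>) - 1) * ccov M N (X 1) (X 2) (N \<omega>))
    (\<theta>12 / 4 * Ddiff M X ^ 2 * (R_moment 2 0 - R_moment 1 0) - \<theta>012 / 8 * Ddiff M X ^ 2 * (R_moment 2 1 - R_moment 1 1)
      - \<theta>01 ^ 2 / 16 * Ddiff M X ^ 2 * (R_moment 2 2 - R_moment 1 2))" (is "has_bochner_integral M _ ?v")
proof -
  let ?r = "\<lambda>p q \<omega>. real (N \<omega>) ^ p * Rratio M N (N \<omega>) ^ q"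
  have i: "has_bochner_integral M (\<lambda>\<omega>. \<theta>12 / 4 * Ddiff M X ^ 2 * (?r 2 0 \<omega> - ?r 1 0 \<omega>)
      - \<theta>012 / 8 * Ddiff M X ^ 2 * (?r 2 1 \<omega> - ?r 1 1 \<omega>)
      - \<theta>01 ^ 2 / 16 * Ddiff M X ^ 2 * (?r 2 2 \<omega> - ?r 1 2 \<omega>)) ?v"
    by (intro has_bochner_integral_diff has_bochner_integral_mult_right
      R_moment_has_bochner_integral) simp_all
  show ?thesis
  proof (rule has_bochner_integral_cong_AE[THEN iffD1, OF _ _ _ i])
    show "AE \<omega> in M. \<theta>12 / 4 * Ddiff M X ^ 2 * (?r 2 0 \<omega> - ?r 1 0 \<omega>)
      - \<theta>012 / 8 * Ddiff M X ^ 2 * (?r 2 1 \<omega> - ?r 1 1 \<omega>)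
      - \<theta>01 ^ 2 / 16 * Ddiff M X ^ 2 * (?r 2 2 \<omega> - ?r 1 2 \<omega>)
      = real (N \<omega>) * (real (N \<omega>) - 1) * ccov M N (X 1) (X 2) (N \<omega>)"
      using AE_gammaN_pos
    proof eventually_elim
      case (elim \<omega>)
      consider "N \<omega> = 0" | "N \<omega> = 1" | "2 \<le> N \<omega>" by linarith
      then show ?case
      proof cases
        case 3
        then have "1 \<le> N \<omega>" by simp
        show ?thesis
          unfolding ccov_def cexp_X2[OF elim 3] cexp_X1[OF elim \<open>1 \<le> N \<omega>\<close>] cexp_X1X2[OF elim 3]
          by (simp add: field_simps power2_eq_square)
      qed simp_all
    qed
  qed measurable
qed

lemma has_bochner_integral_N_cexp:
  defines "m \<equiv> expectation (X 1)"
  shows "has_bochner_integral M (\<lambda>\<omega>. real (N \<omega>) * cexp M N (X 1) (N \<omega>))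
      (m * R_moment 1 0 + \<theta>01 / 4 * Ddiff M X * R_moment 1 1)" (is "has_bochner_integral M _ ?v")
    and "has_bochner_integral M (\<lambda>\<omega>. (real (N \<omega>) * cexp M N (X 1) (N \<omega>)) ^ 2)
      (m ^ 2 * R_moment 2 0 + \<theta>01 / 2 * m * Ddiff M X * R_moment 2 1 + \<theta>01 ^ 2 / 16 * Ddiff M X ^ 2 * R_moment 2 2)"
      (is "has_bochner_integral M _ ?w")
proof -
  let ?r = "\<lambda>p q \<omega>. real (N \<omega>) ^ p * Rratio M N (N \<omega>) ^ q"
  have ae: "AE \<omega> in M. m * ?r 1 0 \<omega> + \<theta>01 / 4 * Ddiff M X * ?r 1 1 \<omega> = real (N \<omega>) * cexp M N (X 1) (N \<omega>)"
    using AE_gammaN_pos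
  proof eventually_elim
    case (elim \<omega>)
    show ?case
    proof (cases "N \<omega> = 0")
      case False
      then have "1 \<le> N \<omega>" by simp
      then show ?thesis
        unfolding cexp_X1[OF elim \<open>1 \<le> N \<omega>\<close>] m_def by (simp add: field_simps)
    qed simp
  qed
  have i: "has_bochner_integral M (\<lambda>\<omega>. m * ?r 1 0 \<omega> + \<theta>01 / 4 * Ddiff M X * ?r 1 1 \<omega>) ?v"
    by (intro has_bochner_integral_add has_bochner_integral_mult_right R_moment_has_bochner_integral) simp_all
  show "has_bochner_integral M (\<lambda>\<omega>. real (N \<omega>) * cexp M N (X 1) (N \<omega>)) ?v"
    by (rule has_bochner_integral_cong_AE[THEN iffD1, OF _ _ ae i]) measurable
  have i: "has_bochner_integral M (\<lambda>\<omega>. m ^ 2 * ?r 2 0 \<omega> + \<theta>01 / 2 * m * Ddiff M X * ?r 2 1 \<omega>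
      + \<theta>01 ^ 2 / 16 * Ddiff M X ^ 2 * ?r 2 2 \<omega>) ?w"
    by (intro has_bochner_integral_add has_bochner_integral_mult_right R_moment_has_bochner_integral) simp_all
  have ae': "AE \<omega> in M. m ^ 2 * ?r 2 0 \<omega> + \<theta>01 / 2 * m * Ddiff M X * ?r 2 1 \<omega>
      + \<theta>01 ^ 2 / 16 * Ddiff M X ^ 2 * ?r 2 2 \<omega> = (real (N \<omega>) * cexp M N (X 1) (N \<omega>)) ^ 2"
    using ae
  proof eventually_elim
    case (elim \<omega>)
    show ?case unfolding elim[symmetric] by (simp add: field_simps power2_eq_square)
  qed
  show "has_bochner_integral M (\<lambda>\<omega>. (real (N \<omega>) * cexp M N (X 1) (N \<omega>)) ^ 2) ?w"
    by (rule has_bochner_integral_cong_AE[THEN iffD1, OF _ _ ae' i]) measurable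
qed

text \<open>With e, q, p the conditional means of X_1, X_1^2 and X_1 X_2 at n, the point is n(q -
  e^2) + n(n - 1)(p - e^2) + (ne)^2 = nq + n(n - 1)p, the conditional second moment of S.\<close>

lemma variance_aggS:
  "variance (aggS N X) = expectation (\<lambda>\<omega>. real (N \<omega>) * cvar M N (X 1) (N \<omega>))
    + expectation (\<lambda>\<omega>. real (N \<omega>) * (real (N \<omega>) - 1) * ccov M N (X 1) (X 2) (N \<omega>))
    + variance (\<lambda>\<omega>. real (N \<omega>) * cexp M N (X 1) (N \<omega>))"
proof -
  note cv = has_bochner_integral_N_cvar[unfolded has_bochner_integral_iff, THEN conjunct1]
  note cc = has_bochner_integral_N_ccov[unfolded has_bochner_integral_iff, THEN conjunct1]
  note c1 = has_bochner_integral_N_cexp(1)[unfolded has_bochner_integral_iff, THEN conjunct1]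
  note c2 = has_bochner_integral_N_cexp(2)[unfolded has_bochner_integral_iff, THEN conjunct1]
  let ?h = "\<lambda>n. real n * cexp M N (\<lambda>\<omega>. X 1 \<omega> ^ 2) n + real n * (real n - 1) * cexp M N (\<lambda>\<omega>. X 1 \<omega> * X 2 \<omega>) n"
  have ae: "AE \<omega> in M. real (N \<omega>) * cvar M N (X 1) (N \<omega>)
      + real (N \<omega>) * (real (N \<omega>) - 1) * ccov M N (X 1) (X 2) (N \<omega>)
      + (real (N \<omega>) * cexp M N (X 1) (N \<omega>)) ^ 2 = ?h (N \<omega>)"
    using AE_gammaN_pos
  proof eventually_elim
    case (elim \<omega>)
    consider "N \<omega> = 0" | "N \<omega> = 1" | "2 \<le> N \<omega>" by linarith
    then show ?case
    proof cases
      case 3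
      show ?thesis
        unfolding ccov_def cvar_def cexp_X2[OF elim 3] by (simp add: field_simps power2_eq_square)
    qed (simp_all add: cvar_def)
  qed
  have i: "integrable M (\<lambda>\<omega>. real (N \<omega>) * cvar M N (X 1) (N \<omega>)
      + real (N \<omega>) * (real (N \<omega>) - 1) * ccov M N (X 1) (X 2) (N \<omega>)
      + (real (N \<omega>) * cexp M N (X 1) (N \<omega>)) ^ 2)"
    by (intro Bochner_Integration.integrable_add cv cc c2)
  have h: "integrable M (\<lambda>\<omega>. ?h (N \<omega>))"
    by (rule integrable_cong_AE_imp[OF i]) (measurable, use ae in eventually_elim, simp)
  have S1: "integrable M (aggS N X)" "expectation (aggS N X) = expectation (\<lambda>\<omega>. real (N \<omega>) * cexp M N (X 1) (N \<omega>))"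
    using tower_nat[OF N_measurable aggS_measurable aggS_nonneg indicator_aggS c1] by auto
  have m2: "(\<lambda>\<omega>. aggS N X \<omega> ^ 2) \<in> borel_measurable M" by measurable
  have p2: "AE \<omega> in M. 0 \<le> aggS N X \<omega> ^ 2" by simp
  have S2: "integrable M (\<lambda>\<omega>. aggS N X \<omega> ^ 2)" "expectation (\<lambda>\<omega>. aggS N X \<omega> ^ 2) = expectation (\<lambda>\<omega>. ?h (N \<omega>))"
    using tower_nat[OF N_measurable m2 p2 indicator_aggS_sq h] by auto
  have "expectation (\<lambda>\<omega>. ?h (N \<omega>)) = expectation (\<lambda>\<omega>. real (N \<omega>) * cvar M N (X 1) (N \<omega>)
      + real (N \<omega>) * (real (N \<omega>) - 1) * ccov M N (X 1) (X 2) (N \<omega>)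
      + (real (N \<omega>) * cexp M N (X 1) (N \<omega>)) ^ 2)"
    by (rule integral_cong_AE) (measurable, use ae in eventually_elim, simp)
  also have "\<dots> = expectation (\<lambda>\<omega>. real (N \<omega>) * cvar M N (X 1) (N \<omega>))
    + expectation (\<lambda>\<omega>. real (N \<omega>) * (real (N \<omega>) - 1) * ccov M N (X 1) (X 2) (N \<omega>))
    + expectation (\<lambda>\<omega>. (real (N \<omega>) * cexp M N (X 1) (N \<omega>)) ^ 2)"
    by (subst Bochner_Integration.integral_add, intro Bochner_Integration.integrable_add cv cc, rule c2,
        subst Bochner_Integration.integral_add[OF cv cc], rule refl)
  finally show ?thesis
    unfolding variance_eq[OF S1(1) S2(1)] variance_eq[OF c1 c2]
    unfolding S1(2) S2(2) by linarith
qed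

section \<open>Closed forms\<close>

lemma lawX_moments:
  "mom1 (lawX M X) = expectation (X 1)"
  "var (lawX M X) = expectation (\<lambda>\<omega>. X 1 \<omega> ^ 2) - (expectation (X 1)) ^ 2"
  by (simp_all add: var_def mom1_def mom2_def lawX_def integral_distr del: One_nat_def)

lemma expectation_X1_eq_max2_min2:
  "expectation (X 1) = (mom1 (law_max2 (lawX M X)) + mom1 (law_min2 (lawX M X))) / 2"
  using mom1_max2_plus_min2[OF intX1] unfolding lawX_def by simp

lemma mom1_lawN_eq_max2_min2:
  "mom1 (lawN M N) = (mom1 (law_max2 (lawN M N)) + mom1 (law_min2 (lawN M N))) / 2"
  using mom1_max2_plus_min2[OF intN1] R_moment_0(1) unfolding lawN_def by simp

lemma expectation_N_cvar:
  "expectation (\<lambda>\<omega>. real (N \<omega>) * cvar M N (X 1) (N \<omega>))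
    = mom1 (lawN M N) * var (lawX M X)
      + \<theta>01 / 4 * (mom1 (law_max2 (lawN M N)) - mom1 (law_min2 (lawN M N)))
          * (var (law_max2 (lawX M X)) - var (law_min2 (lawX M X)))
      - \<theta>01 ^ 2 / 16 * (Ddiff M X) ^ 2 * (\<Sum>n. gammaN M N n * real n * (Rratio M N n) ^ 2)"
proof -
  \<comment> \<open>Twice the mean of X is the sum of the means of maximum and minimum, so 2 E[X] D
    is the difference of their squares.\<close>
  have v: "mom2 (law_max2 (lawX M X)) - mom2 (law_min2 (lawX M X)) - 2 * expectation (X 1) * Ddiff M X
    = var (law_max2 (lawX M X)) - var (law_min2 (lawX M X))"
    unfolding var_def Ddiff_def expectation_X1_eq_max2_min2 by (simp add: field_simps power2_eq_square)
  show ?thesis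
    unfolding has_bochner_integral_integral_eq[OF has_bochner_integral_N_cvar] R_moment_0 R_moment_1 R_moment_2 v lawX_moments
    by (simp add: mult_ac)
qed

lemma expectation_N_ccov:
  "expectation (\<lambda>\<omega>. real (N \<omega>) * (real (N \<omega>) - 1) * ccov M N (X 1) (X 2) (N \<omega>))
    = \<theta>12 / 4 * (mom2 (lawN M N) - mom1 (lawN M N)) * (Ddiff M X) ^ 2
      - \<theta>012 / 8 * (mom2 (law_max2 (lawN M N)) - mom1 (law_max2 (lawN M N))
                    - mom2 (law_min2 (lawN M N)) + mom1 (law_min2 (lawN M N))) * (Ddiff M X) ^ 2
      - \<theta>01 ^ 2 / 16 * (Ddiff M X) ^ 2 * (\<Sum>n. gammaN M N n * (real n) ^ 2 * (Rratio M N n) ^ 2)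
      + \<theta>01 ^ 2 / 16 * (Ddiff M X) ^ 2 * (\<Sum>n. gammaN M N n * real n * (Rratio M N n) ^ 2)"
  unfolding has_bochner_integral_integral_eq[OF has_bochner_integral_N_ccov] R_moment_0 R_moment_1 R_moment_2
  by (simp add: field_simps)

lemma variance_N_cexp:
  "variance (\<lambda>\<omega>. real (N \<omega>) * cexp M N (X 1) (N \<omega>))
    = var (lawN M N) * (mom1 (lawX M X)) ^ 2
      + \<theta>01 / 4 * (var (law_max2 (lawN M N)) - var (law_min2 (lawN M N)))
          * ((mom1 (law_max2 (lawX M X))) ^ 2 - (mom1 (law_min2 (lawX M X))) ^ 2)
      + \<theta>01 / 8 * ((mom1 (law_max2 (lawN M N))) ^ 2 - (mom1 (law_min2 (lawN M N))) ^ 2)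
          * ((mom1 (law_max2 (lawX M X))) ^ 2 - (mom1 (law_min2 (lawX M X))) ^ 2)
      + \<theta>01 ^ 2 / 16 * (Ddiff M X) ^ 2 * (\<Sum>n. gammaN M N n * (real n) ^ 2 * (Rratio M N n) ^ 2)
      - \<theta>01 ^ 2 / 16 * (mom1 (law_max2 (lawN M N)) - mom1 (law_min2 (lawN M N))) ^ 2
          * (Ddiff M X) ^ 2"
proof -
  note c = has_bochner_integral_N_cexp
  define m where "m = expectation (X 1)"
  have sqX: "(mom1 (law_max2 (lawX M X))) ^ 2 - (mom1 (law_min2 (lawX M X))) ^ 2 = 2 * m * Ddiff M X"
    unfolding m_def Ddiff_def expectation_X1_eq_max2_min2 by (simp add: field_simps power2_eq_square)
  have "variance (\<lambda>\<omega>. real (N \<omega>) * cexp M N (X 1) (N \<omega>))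
    = expectation (\<lambda>\<omega>. (real (N \<omega>) * cexp M N (X 1) (N \<omega>)) ^ 2)
      - (expectation (\<lambda>\<omega>. real (N \<omega>) * cexp M N (X 1) (N \<omega>))) ^ 2"
    by (rule variance_eq[OF c(1)[unfolded has_bochner_integral_iff, THEN conjunct1]
      c(2)[unfolded has_bochner_integral_iff, THEN conjunct1]])
  \<comment> \<open>The theta01/8 term balances two contributions: passing from second moments of N
    to variances adds theta01/4 times the difference of squared means of maximum and minimum, and
    the cross term of the squared expectation, with E[N] as half the sum of these means, removes
    half of it.\<close>
  then show ?thesis
    unfolding c[THEN has_bochner_integral_integral_eq] R_moment_0 R_moment_1 R_moment_2 sqX lawX_moments(1) var_def mom1_lawN_eq_max2_min2
      m_def[symmetric]
    by (simp add: field_simps power2_eq_square)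
qed

end

theorem mainTheorem10:
  fixes M :: "'a measure" and N :: "'a \<Rightarrow> nat" and X :: "nat \<Rightarrow> 'a \<Rightarrow> real"
    and \<theta> :: "nat \<Rightarrow> nat set \<Rightarrow> real" and \<theta>01 \<theta>12 \<theta>012 :: real
  assumes crm: "CRM M N X"
    and fgm: "in_FGM_star M N X \<theta>"
    and par01: "\<And>k j. crm_index M N k \<Longrightarrow> j \<in> {1..k} \<Longrightarrow> \<theta> k {0, j} = \<theta>01"
    and par12: "\<And>k i j. crm_index M N k \<Longrightarrow> 1 \<le> i \<Longrightarrow> i < j \<Longrightarrow> j \<le> k \<Longrightarrow> \<theta> k {i, j} = \<theta>12"
    and par012: "\<And>k i j. crm_index M N k \<Longrightarrow> 1 \<le> i \<Longrightarrow> i < j \<Longrightarrow> j \<le> k \<Longrightarrow> \<theta> k {0, i, j} = \<theta>012"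
    and intN1: "integrable M (\<lambda>\<omega>. real (N \<omega>))"
    and intN2: "integrable M (\<lambda>\<omega>. real (N \<omega>) ^ 2)"
    and intX1: "integrable M (X 1)"
    and intX2: "integrable M (\<lambda>\<omega>. X 1 \<omega> ^ 2)"
  shows "prob_space.variance M (aggS N X) =
           prob_space.expectation M (\<lambda>\<omega>. real (N \<omega>) * cvar M N (X 1) (N \<omega>))
         + prob_space.expectation M
             (\<lambda>\<omega>. real (N \<omega>) * (real (N \<omega>) - 1) * ccov M N (X 1) (X 2) (N \<omega>))
         + prob_space.variance M (\<lambda>\<omega>. real (N \<omega>) * cexp M N (X 1) (N \<omega>))
    \<and> prob_space.expectation M (\<lambda>\<omega>. real (N \<omega>) * cvar M N (X 1) (N \<omega>))
        = mom1 (lawN M N) * var (lawX M X)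
          + \<theta>01 / 4 * (mom1 (law_max2 (lawN M N)) - mom1 (law_min2 (lawN M N)))
              * (var (law_max2 (lawX M X)) - var (law_min2 (lawX M X)))
          - \<theta>01 ^ 2 / 16 * (Ddiff M X) ^ 2 * (\<Sum>n. gammaN M N n * real n * (Rratio M N n) ^ 2)
    \<and> prob_space.expectation M
             (\<lambda>\<omega>. real (N \<omega>) * (real (N \<omega>) - 1) * ccov M N (X 1) (X 2) (N \<omega>))
        = \<theta>12 / 4 * (mom2 (lawN M N) - mom1 (lawN M N)) * (Ddiff M X) ^ 2
          - \<theta>012 / 8 * (mom2 (law_max2 (lawN M N)) - mom1 (law_max2 (lawN M N))
                        - mom2 (law_min2 (lawN M N)) + mom1 (law_min2 (lawN M N))) * (Ddiff M X) ^ 2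
          - \<theta>01 ^ 2 / 16 * (Ddiff M X) ^ 2 * (\<Sum>n. gammaN M N n * (real n) ^ 2 * (Rratio M N n) ^ 2)
          + \<theta>01 ^ 2 / 16 * (Ddiff M X) ^ 2 * (\<Sum>n. gammaN M N n * real n * (Rratio M N n) ^ 2)
    \<and> prob_space.variance M (\<lambda>\<omega>. real (N \<omega>) * cexp M N (X 1) (N \<omega>))
        = var (lawN M N) * (mom1 (lawX M X)) ^ 2
          + \<theta>01 / 4 * (var (law_max2 (lawN M N)) - var (law_min2 (lawN M N)))
              * ((mom1 (law_max2 (lawX M X))) ^ 2 - (mom1 (law_min2 (lawX M X))) ^ 2)
          + \<theta>01 / 8 * ((mom1 (law_max2 (lawN M N))) ^ 2 - (mom1 (law_min2 (lawN M N))) ^ 2)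
              * ((mom1 (law_max2 (lawX M X))) ^ 2 - (mom1 (law_min2 (lawX M X))) ^ 2)
          + \<theta>01 ^ 2 / 16 * (Ddiff M X) ^ 2 * (\<Sum>n. gammaN M N n * (real n) ^ 2 * (Rratio M N n) ^ 2)
          - \<theta>01 ^ 2 / 16 * (mom1 (law_max2 (lawN M N)) - mom1 (law_min2 (lawN M N))) ^ 2
              * (Ddiff M X) ^ 2
    \<and> prob_space.variance M (aggS N X)
        = mom1 (lawN M N) * var (lawX M X) + var (lawN M N) * (mom1 (lawX M X)) ^ 2
          + (\<theta>01 / 4 *
               ((mom1 (law_max2 (lawN M N)) - mom1 (law_min2 (lawN M N)))
                  * (var (law_max2 (lawX M X)) - var (law_min2 (lawX M X)))
                + (var (law_max2 (lawN M N)) - var (law_min2 (lawN M N)))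
                  * ((mom1 (law_max2 (lawX M X))) ^ 2 - (mom1 (law_min2 (lawX M X))) ^ 2)
                + 1 / 2 * ((mom1 (law_max2 (lawN M N))) ^ 2 - (mom1 (law_min2 (lawN M N))) ^ 2)
                  * ((mom1 (law_max2 (lawX M X))) ^ 2 - (mom1 (law_min2 (lawX M X))) ^ 2))
             - \<theta>01 ^ 2 / 16 * (mom1 (law_max2 (lawN M N)) - mom1 (law_min2 (lawN M N))) ^ 2
                 * (Ddiff M X) ^ 2
             + \<theta>12 / 4 * (mom2 (lawN M N) - mom1 (lawN M N)) * (Ddiff M X) ^ 2
             - \<theta>012 / 8 * ((mom2 (law_max2 (lawN M N)) - mom1 (law_max2 (lawN M N)))
                           - (mom2 (law_min2 (lawN M N)) - mom1 (law_min2 (lawN M N))))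
                 * (Ddiff M X) ^ 2)"
proof -
  interpret prob_space M
    using crm by (simp add: CRM_def)
  interpret fgm_collective_risk M N X \<theta> \<theta>01 \<theta>12 \<theta>012
    by unfold_locales (fact crm fgm par01 par12 par012 intN1 intN2 intX1 intX2)+
  show ?thesis
  proof (intro conjI variance_aggS expectation_N_cvar expectation_N_ccov variance_N_cexp)
    show "variance (aggS N X)
        = mom1 (lawN M N) * var (lawX M X) + var (lawN M N) * (mom1 (lawX M X)) ^ 2
          + (\<theta>01 / 4 *
               ((mom1 (law_max2 (lawN M N)) - mom1 (law_min2 (lawN M N)))
                  * (var (law_max2 (lawX M X)) - var (law_min2 (lawX M X)))
                + (var (law_max2 (lawN M N)) - var (law_min2 (lawN M N)))
                  * ((mom1 (law_max2 (lawX M X))) ^ 2 - (mom1 (law_min2 (lawX M X))) ^ 2)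
                + 1 / 2 * ((mom1 (law_max2 (lawN M N))) ^ 2 - (mom1 (law_min2 (lawN M N))) ^ 2)
                  * ((mom1 (law_max2 (lawX M X))) ^ 2 - (mom1 (law_min2 (lawX M X))) ^ 2))
             - \<theta>01 ^ 2 / 16 * (mom1 (law_max2 (lawN M N)) - mom1 (law_min2 (lawN M N))) ^ 2
                 * (Ddiff M X) ^ 2
             + \<theta>12 / 4 * (mom2 (lawN M N) - mom1 (lawN M N)) * (Ddiff M X) ^ 2
             - \<theta>012 / 8 * ((mom2 (law_max2 (lawN M N)) - mom1 (law_max2 (lawN M N)))
                           - (mom2 (law_min2 (lawN M N)) - mom1 (law_min2 (lawN M N))))
                 * (Ddiff M X) ^ 2)"
      \<comment> \<open>The series in n R^2 cancels between the first two parts and the series in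
        n^2 R^2 between the last two.\<close>
      unfolding variance_aggS expectation_N_cvar expectation_N_ccov variance_N_cexp
      by (simp add: field_simps)
  qed
qed

end
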